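(* Let $k$ be a positive integer, let $\mathbb{E}$ be a real Banach space, and let $f=(f_{i_1,\dots,i_k})$ be a finitely supported, diagonal-free array of vectors of $\mathbb{E}$. Let $\xi=(\xi_i)_{i\ge1}$ and $\xi_j=(\xi_{ji})_{i\ge1}$, $j=1,\dots,k$, be sequences of independent real random variables (each sequence has independent entries; integrability is not assumed). (A$''$) Let the sequences $\xi,\xi_1,\xi_2,\dots$ be independent, identically distributed and symmetric. Then there exists a constant $A''$, depending only on $k$, such that for all $t\ge0$ $$P\big(\|Q(f;\xi^k)\|\ge A''t\big)\le A''\,P\big(\|Q(f;\xi_1,\dots,\xi_k)\|\ge t\big).$$ (B$''$) Let the sequences $\xi,\xi_1,\dots,\xi_k$ be interchangeable. Then there exists a constant $B''$, depending only on $k$, such that for all $t\ge0$ $$P\big(\|\widehat Q(f;\xi_1,\dots,\xi_k)\|\ge B''t\big)\le B''\,P\big(\|Q(f;\xi^k)\|\ge t\big).$$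
   Context: Diagonal-free: $f_{i_1,\dots,i_k}=0$ whenever at least two of the indices coincide. Finitely supported: only finitely many $f_{i_1,\dots,i_k}$ are nonzero. Sequences are interchangeable if every permutation of them has the same joint distribution. A real random variable $X$ is symmetric if $X$ and $-X$ have the same distribution; a sequence of independent variables is symmetric if its entries are. $Q(f;\xi_1,\dots,\xi_k)=\sum_{i_1,\dots,i_k}f_{i_1,\dots,i_k}\,\xi_{1i_1}\cdots\xi_{ki_k}$ and $Q(f;\xi^k)=\sum_{i_1,\dots,i_k}f_{i_1,\dots,i_k}\,\xi_{i_1}\cdots\xi_{i_k}$. Symmetrization: $\widehat f_{i_1,\dots,i_k}=\frac1{k!}\sum_\sigma f_{i_{\sigma(1)},\dots,i_{\sigma(k)}}$ over all permutations $\sigma$ of $\{1,\dots,k\}$, and $\widehat Q(f;\cdot)=Q(\widehat f;\cdot)$. The norm $\|\cdot\|$ is that of $\mathbb{E}$.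
   Formalization: In (B'') the vectors (ξ_i, ξ_{1i}, …, ξ_{ki}), i ≥ 1, are assumed independent of each other (dependence within a vector is allowed); with only independent entries in each single sequence, (B'') is false already for k = 2. *)

theory Defs
  imports "HOL-Probability.Probability" "HOL-Combinatorics.Combinatorics"
begin

(* A real Banach space is given by a carrier V and a norm N inside an ambient real vector
   space, and not by a type of class banach, so that the constants of the theorem can be
   chosen before the Banach space. *)
definition banach_space_on :: "'e::real_vector set \<Rightarrow> ('e \<Rightarrow> real) \<Rightarrow> bool" where
  "banach_space_on V N \<longleftrightarrow>
     subspace V \<and>
     (\<forall>x\<in>V. N x \<ge> 0) \<and>
     (\<forall>x\<in>V. N x = 0 \<longleftrightarrow> x = 0) \<and>
     (\<forall>x\<in>V. \<forall>a. N (a *\<^sub>R x) = \<bar>a\<bar> * N x) \<and>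
     (\<forall>x\<in>V. \<forall>y\<in>V. N (x + y) \<le> N x + N y) \<and>
     Metric_space.mcomplete V (\<lambda>x y. N (x - y))"

lemma banach_space_on_UNIV: "banach_space_on (UNIV :: 'e::banach set) norm"
proof -
  have "Metric_space.mcomplete (UNIV :: 'e set) dist"
    by (simp add: mcomplete_iff_complete complete_UNIV)
  moreover have "dist = (\<lambda>x y :: 'e. norm (x - y))"
    by (intro ext) (rule dist_norm)
  ultimately have "Metric_space.mcomplete (UNIV :: 'e set) (\<lambda>x y. norm (x - y))"
    by simp
  then show ?thesis
    unfolding banach_space_on_def by (auto simp: subspace_UNIV norm_triangle_ineq)
qed

(* An array of order k is a function on index lists (i_1, ..., i_k) of length k; its values on
   lists of other lengths are irrelevant. Indices, and the positions in an index list, are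
   counted from 0. *)

definition finitely_supported :: "nat \<Rightarrow> (nat list \<Rightarrow> 'e::zero) \<Rightarrow> bool" where
  "finitely_supported k f \<longleftrightarrow> finite {v. length v = k \<and> f v \<noteq> 0}"

definition diagonal_free :: "nat \<Rightarrow> (nat list \<Rightarrow> 'e::zero) \<Rightarrow> bool" where
  "diagonal_free k f \<longleftrightarrow> (\<forall>v. length v = k \<and> \<not> distinct v \<longrightarrow> f v = 0)"

(* The multilinear form Q(f; X 0, ..., X (k-1)); in particular Q(f; x^k) is Q k f (\<lambda>_. x). *)
definition Q :: "nat \<Rightarrow> (nat list \<Rightarrow> 'e::real_vector) \<Rightarrow> (nat \<Rightarrow> nat \<Rightarrow> 'a \<Rightarrow> real) \<Rightarrow> 'a \<Rightarrow> 'e" where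
  "Q k f X \<omega> = (\<Sum>v | length v = k \<and> f v \<noteq> 0. (\<Prod>j<k. X j (v ! j) \<omega>) *\<^sub>R f v)"

definition symmetrization :: "nat \<Rightarrow> (nat list \<Rightarrow> 'e::real_vector) \<Rightarrow> nat list \<Rightarrow> 'e" where
  "symmetrization k f v = (1 / fact k) *\<^sub>R (\<Sum>\<sigma> | \<sigma> permutes {..<k}. f (permute_list \<sigma> v))"

abbreviation seq_space :: "(nat \<Rightarrow> real) measure" where
  "seq_space \<equiv> PiM UNIV (\<lambda>_. borel)"

definition indep_entries :: "'a measure \<Rightarrow> (nat \<Rightarrow> 'a \<Rightarrow> real) \<Rightarrow> bool" where
  "indep_entries M X \<longleftrightarrow> prob_space.indep_vars M (\<lambda>_. borel) X UNIV"

definition symmetric_rv :: "'a measure \<Rightarrow> ('a \<Rightarrow> real) \<Rightarrow> bool" where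
  "symmetric_rv M X \<longleftrightarrow>
     X \<in> borel_measurable M \<and> distr M borel X = distr M borel (\<lambda>\<omega>. - X \<omega>)"

(* The next four notions concern the k + 1 sequences S 0, ..., S k; the i-th entry of the
   j-th sequence is S j i. *)

definition indep_sequences :: "'a measure \<Rightarrow> nat \<Rightarrow> (nat \<Rightarrow> nat \<Rightarrow> 'a \<Rightarrow> real) \<Rightarrow> bool" where
  "indep_sequences M k S \<longleftrightarrow>
     prob_space.indep_vars M (\<lambda>_. seq_space) (\<lambda>j \<omega> i. S j i \<omega>) {..k}"

definition ident_distr_sequences :: "'a measure \<Rightarrow> nat \<Rightarrow> (nat \<Rightarrow> nat \<Rightarrow> 'a \<Rightarrow> real) \<Rightarrow> bool" where
  "ident_distr_sequences M k S \<longleftrightarrow>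
     (\<forall>j\<le>k. distr M seq_space (\<lambda>\<omega> i. S j i \<omega>) = distr M seq_space (\<lambda>\<omega> i. S 0 i \<omega>))"

definition interchangeable :: "'a measure \<Rightarrow> nat \<Rightarrow> (nat \<Rightarrow> nat \<Rightarrow> 'a \<Rightarrow> real) \<Rightarrow> bool" where
  "interchangeable M k S \<longleftrightarrow>
     (\<forall>j\<le>k. \<forall>i. S j i \<in> borel_measurable M) \<and>
     (\<forall>\<pi>. \<pi> permutes {..k} \<longrightarrow>
        distr M (PiM {..k} (\<lambda>_. seq_space)) (\<lambda>\<omega>. \<lambda>j\<in>{..k}. \<lambda>i. S (\<pi> j) i \<omega>) =
        distr M (PiM {..k} (\<lambda>_. seq_space)) (\<lambda>\<omega>. \<lambda>j\<in>{..k}. \<lambda>i. S j i \<omega>))"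

(* The random vectors (S 0 i, ..., S k i), i = 0, 1, 2, ..., are independent; nothing is assumed
   about the dependence inside a vector. This is how "sequences of independent random variables"
   is read for sequences that need not be independent of each other. Independence of the entries
   of each single sequence is too weak for the inequality B: let a, b be independent with
   P(a = 1) = P(b = 1) = p, P(a = 0) = P(b = 0) = 1 - p, and put the three sequences
   (a, b, 0, 0, ...), (b, a, 0, 0, ...), (a, b, 0, 0, ...) in an independent uniformly random
   order. They are interchangeable with independent entries, but for k = 2, with f equal to 1 at
   (0, 1) and to 0 elsewhere, the inequality fails for small p: Q(f; \<xi>^2) = a b is nonzero with
   probability p^2, while with probability 2/3 the symmetrized form is (a^2 + b^2) / 2. *)
definition jointly_indep_entries :: "'a measure \<Rightarrow> nat \<Rightarrow> (nat \<Rightarrow> nat \<Rightarrow> 'a \<Rightarrow> real) \<Rightarrow> bool" where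
  "jointly_indep_entries M k S \<longleftrightarrow>
     prob_space.indep_vars M (\<lambda>_. PiM {..k} (\<lambda>_. borel)) (\<lambda>i \<omega>. \<lambda>j\<in>{..k}. S j i \<omega>) UNIV"

lemma jointly_indep_entries_imp_indep_entries:
  assumes "prob_space M" "jointly_indep_entries M k S" "j \<le> k"
  shows "indep_entries M (S j)"
proof -
  interpret prob_space M by fact
  have "indep_vars (\<lambda>_. borel) (\<lambda>i \<omega>. (\<lambda>j\<in>{..k}. S j i \<omega>) j) UNIV"
    using assms(2) unfolding jointly_indep_entries_def
    by (rule indep_vars_compose2[where Y = "\<lambda>_ x. x j"]) (use assms(3) in simp)
  then show ?thesis
    using assms(3) by (simp add: indep_entries_def)
qed

end

theory Submission
  imports Defs
begin

text \<open>
  Both inequalities follow from one principle. Suppose that a family of random variables can be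
  transformed, separately at each index \<open>i\<close>, in finitely many ways, and that every choice \<open>\<tau>\<close> of
  transformations leaves the law of the norm of the chaos unchanged. Choose the \<open>\<tau> i\<close> uniformly and
  independently. For a fixed sample point the chaos is then a vector-valued function of \<open>\<tau>\<close> of degree at
  most \<open>k\<close>, and because \<open>f\<close> is diagonal-free its mean over \<open>\<tau>\<close> is the chaos of the averaged variables.
  Such a function is, with probability at least a constant depending only on \<open>k\<close> and the number of
  transformations, at least half as large in norm as its mean (\<open>anticoncentration\<close>). Integrating over
  the sample points yields \<open>randomized_choice\<close>: the tail of the chaos of the averaged variables is
  controlled by the tail of the original one.

  The anticoncentration is reduced to real functions by a linear functional that norms the mean; the
  only vectors involved lie in a finitely generated subspace, so the functional is obtained by
  finitely many one-dimensional extensions (\<open>norming_functional\<close>). For real functions it is the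
  Paley-Zygmund argument, fed by Bonami's comparison of the fourth and second moments
  (\<open>hypercontractive\<close>).

  For (A) the transformations act on the column \<open>(\<xi>\<^sub>i, \<xi>\<^sub>1\<^sub>i, \<dots>, \<xi>\<^sub>k\<^sub>i)\<close>: one slot \<open>r\<close> receives
  \<open>\<xi>\<^sub>i\<close> and all the other slots are multiplied by a common sign. Independence, equality of the laws and
  symmetry make this law-preserving, and the signs cancel everything in the mean except \<open>\<xi>\<^sub>i / k\<close>, the
  same in every slot. So the averaged chaos is a multiple of \<open>Q(f; \<xi>\<^sup>k)\<close>.

  For (B), replacing \<open>\<xi>\<^sub>i\<close> by one of the \<open>\<xi>\<^sub>a\<^sub>i\<close>, \<open>a \<in> A\<close>, does not change the law of \<open>Q(f; \<xi>\<^sup>k)\<close>, so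
  the principle controls the coupled chaos of the mean of the sequences in \<open>A\<close> for each nonempty set
  \<open>A\<close>. The polarization identity expresses the symmetrized decoupled chaos through these
  \<open>2\<^sup>k - 1\<close> quantities (\<open>Q_symmetrization\<close>), and a union bound finishes the proof.
\<close>

section \<open>Averages over finite sets\<close>

definition avg :: "'x set \<Rightarrow> ('x \<Rightarrow> 'b::real_vector) \<Rightarrow> 'b" where
  "avg T F = (1 / real (card T)) *\<^sub>R (\<Sum>x\<in>T. F x)"

lemma avg_add: "avg T (\<lambda>x. F x + G x) = avg T F + avg T G"
  by (simp add: avg_def sum.distrib scaleR_add_right)

lemma avg_diff: "avg T (\<lambda>x. F x - G x) = avg T F - avg T G"
  by (simp add: avg_def sum_subtractf scaleR_diff_right)

lemma avg_sum: "avg T (\<lambda>x. \<Sum>a\<in>A. F a x) = (\<Sum>a\<in>A. avg T (F a))"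
  unfolding avg_def by (subst sum.swap) (simp add: scaleR_sum_right)

lemma avg_scaleR: "avg T (\<lambda>x. g x *\<^sub>R v) = avg T g *\<^sub>R v"
  by (simp add: avg_def flip: scaleR_sum_left)

lemma avg_mult_left: "avg T (\<lambda>x. c * g x) = c * avg T g" for c :: real
  by (simp add: avg_def sum_distrib_left)

lemma avg_const: "finite T \<Longrightarrow> T \<noteq> {} \<Longrightarrow> avg T (\<lambda>_. c) = c"
  by (simp add: avg_def sum_constant_scaleR)

lemma avg_mono: "(\<And>x. x \<in> T \<Longrightarrow> F x \<le> G x) \<Longrightarrow> avg T F \<le> avg T G" for F :: "_ \<Rightarrow> real"
  unfolding avg_def by (intro scaleR_left_mono sum_mono) auto

lemma avg_nonneg: "(\<And>x. x \<in> T \<Longrightarrow> 0 \<le> F x) \<Longrightarrow> 0 \<le> avg T F" for F :: "_ \<Rightarrow> real"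
  unfolding avg_def by (auto intro!: sum_nonneg divide_nonneg_nonneg)

lemma linear_avg: "linear h \<Longrightarrow> h (avg T F) = avg T (\<lambda>x. h (F x))"
  by (simp add: avg_def linear_scale linear_sum)

lemma avg_swap: "avg A (\<lambda>x. avg B (F x)) = avg B (\<lambda>y. avg A (\<lambda>x. F x y))"
  unfolding avg_def by (simp add: scaleR_sum_right mult.commute) (rule sum.swap)

lemma avg_Cauchy_Schwarz: "(avg T (\<lambda>x. F x * G x))\<^sup>2 \<le> avg T (\<lambda>x. (F x)\<^sup>2) * avg T (\<lambda>x. (G x)\<^sup>2)"
  for F G :: "_ \<Rightarrow> real"
  using Cauchy_Schwarz_ineq_sum[of F G T]
  by (simp add: avg_def power_divide power2_eq_square divide_right_mono)

lemma avg_square_le: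
  fixes F :: "'x \<Rightarrow> real"
  assumes "finite T" "T \<noteq> {}"
  shows "(avg T F)\<^sup>2 \<le> avg T (\<lambda>x. (F x)\<^sup>2)"
  using avg_Cauchy_Schwarz[of T F "\<lambda>_. 1"] assms by (simp add: avg_const)

text \<open>The reverse of Jensen's inequality, at the cost of the number of points; it turns an average
  of squared conditional second moments back into a squared second moment.\<close>

lemma avg_of_squares_le:
  fixes F :: "'x \<Rightarrow> real"
  assumes "finite T" "\<And>x. x \<in> T \<Longrightarrow> 0 \<le> F x"
  shows "avg T (\<lambda>x. (F x)\<^sup>2) \<le> real (card T) * (avg T F)\<^sup>2"
proof (cases "T = {}")
  case False
  then have c: "card T > 0" using assms by (simp add: card_gt_0_iff)
  have "(\<Sum>x\<in>T. (F x)\<^sup>2) \<le> (\<Sum>x\<in>T. F x * (\<Sum>x\<in>T. F x))"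
    unfolding power2_eq_square using assms
    by (intro sum_mono mult_left_mono member_le_sum) auto
  also have "\<dots> = (\<Sum>x\<in>T. F x)\<^sup>2"
    by (simp add: sum_distrib_right power2_eq_square)
  finally show ?thesis using c
    by (simp add: avg_def power2_eq_square field_simps)
qed (simp add: avg_def)

lemma avg_PiE_insert:
  assumes "finite I" "i \<notin> I"
  shows "avg (PiE (insert i I) (\<lambda>_. S)) F = avg S (\<lambda>y. avg (PiE I (\<lambda>_. S)) (\<lambda>x. F (x(i := y))))"
proof -
  have "(\<Sum>x\<in>PiE (insert i I) (\<lambda>_. S). F x) = (\<Sum>y\<in>S. \<Sum>x\<in>PiE I (\<lambda>_. S). F (x(i := y)))"
    unfolding PiE_insert_eq using assms
    by (subst sum.reindex[OF inj_combinator]) (auto simp: sum.cartesian_product case_prod_unfold comp_def)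
  with assms show ?thesis
    by (simp add: avg_def card_PiE scaleR_sum_right)
qed

lemma avg_PiE_prod:
  fixes g :: "'i \<Rightarrow> 's \<Rightarrow> real"
  assumes "finite I" "finite S"
  shows "avg (PiE I (\<lambda>_. S)) (\<lambda>x. \<Prod>i\<in>I. g i (x i)) = (\<Prod>i\<in>I. avg S (g i))"
  using assms by (simp add: avg_def prod_sum_PiE card_PiE prod_dividef)

text \<open>The mean of a product of functions of distinct coordinates factorizes. For a chaos,
  distinctness of the coordinates \<open>h j\<close> is what the absence of diagonal terms provides.\<close>

lemma avg_PiE_monomial:
  fixes g :: "'j \<Rightarrow> 's \<Rightarrow> real"
  assumes "finite I" "finite S" "S \<noteq> {}" "finite J" "inj_on h J" "h ` J \<subseteq> I"
  shows "avg (PiE I (\<lambda>_. S)) (\<lambda>x. \<Prod>j\<in>J. g j (x (h j))) = (\<Prod>j\<in>J. avg S (g j))"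
proof -
  define G where "G i = (if i \<in> h ` J then g (inv_into J h i) else (\<lambda>_. 1))" for i
  have *: "(\<Prod>j\<in>J. g j (x (h j))) = (\<Prod>i\<in>I. G i (x i))" for x
  proof -
    have "(\<Prod>i\<in>I. G i (x i)) = (\<Prod>i\<in>h ` J. G i (x i))"
      using assms by (intro prod.mono_neutral_right) (auto simp: G_def)
    also have "\<dots> = (\<Prod>j\<in>J. g j (x (h j)))"
      using assms by (simp add: prod.reindex G_def)
    finally show ?thesis by simp
  qed
  have "(\<Prod>i\<in>I. avg S (G i)) = (\<Prod>i\<in>h ` J. avg S (G i))"
    using assms by (intro prod.mono_neutral_right) (auto simp: G_def avg_const)
  also have "\<dots> = (\<Prod>j\<in>J. avg S (g j))"
    using assms by (simp add: prod.reindex G_def)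
  finally show ?thesis
    using avg_PiE_prod[of I S G] assms by (simp add: *)
qed

section \<open>Functions of low degree on a product set\<close>

text \<open>Degree is measured by iterated differences in single coordinates: a sum of products of at most
  \<open>k\<close> factors, each depending on its own coordinate, has degree at most \<open>k\<close>. Freezing a coordinate
  and averaging over it visibly preserve this notion, and no expansion of the function has to be
  chosen.\<close>

primrec deg_le :: "nat \<Rightarrow> (('i \<Rightarrow> 's) \<Rightarrow> 'b::real_vector) \<Rightarrow> bool" where
  "deg_le 0 F \<longleftrightarrow> (\<forall>x y. F x = F y)"
| "deg_le (Suc k) F \<longleftrightarrow> (\<forall>i y z. deg_le k (\<lambda>x. F (x(i := y)) - F (x(i := z))))"

lemma deg_le_const: "deg_le k (\<lambda>_. c)"
  by (induction k arbitrary: c) auto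

lemma deg_le_linear: "linear h \<Longrightarrow> deg_le k F \<Longrightarrow> deg_le k (\<lambda>x. h (F x))"
proof (induction k arbitrary: F)
  case (Suc k)
  then show ?case by (simp flip: linear_diff)
next
  case 0
  then show ?case unfolding deg_le.simps by metis
qed

lemma deg_le_add: "deg_le k F \<Longrightarrow> deg_le k G \<Longrightarrow> deg_le k (\<lambda>x. F x + G x)"
proof (induction k arbitrary: F G)
  case (Suc k)
  have "deg_le k (\<lambda>x. (F (x(i := y)) - F (x(i := z))) + (G (x(i := y)) - G (x(i := z))))" for i y z
    using Suc by simp
  then show ?case by (simp add: algebra_simps)
next
  case 0
  then show ?case unfolding deg_le.simps by metis
qed

lemma deg_le_sum: "(\<And>a. a \<in> A \<Longrightarrow> deg_le k (F a)) \<Longrightarrow> deg_le k (\<lambda>x. \<Sum>a\<in>A. F a x)"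
  by (induction A rule: infinite_finite_induct) (auto intro: deg_le_const deg_le_add)

lemma deg_le_scaleR: "deg_le k F \<Longrightarrow> deg_le k (\<lambda>x. c *\<^sub>R F x)"
  by (rule deg_le_linear[where h = "\<lambda>v. c *\<^sub>R v"]) auto

lemma deg_le_avg: "(\<And>y. y \<in> S \<Longrightarrow> deg_le k (F y)) \<Longrightarrow> deg_le k (\<lambda>x. avg S (\<lambda>y. F y x))"
  unfolding avg_def by (intro deg_le_scaleR deg_le_sum)

lemma deg_le_update: "deg_le k F \<Longrightarrow> deg_le k (\<lambda>x. F (x(j := w)))"
proof (induction k arbitrary: F)
  case (Suc k)
  show ?case unfolding deg_le.simps
  proof (intro allI)
    fix i y z
    show "deg_le k (\<lambda>x. F (x(i := y, j := w)) - F (x(i := z, j := w)))"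
    proof (cases "i = j")
      case False
      then show ?thesis
        using Suc.IH[of "\<lambda>x. F (x(i := y)) - F (x(i := z))"] Suc.prems
        by (simp add: fun_upd_twist[OF False] del: fun_upd_apply)
    qed (simp add: deg_le_const)
  qed
next
  case 0
  then show ?case unfolding deg_le.simps by blast
qed

text \<open>A difference in one coordinate annihilates a monomial or removes exactly one of its factors.\<close>

lemma deg_le_monomial:
  fixes g :: "'j \<Rightarrow> 's \<Rightarrow> real" and c :: "'b::real_vector"
  assumes "finite J" "card J \<le> k" "inj_on h J"
  shows "deg_le k (\<lambda>x. (\<Prod>j\<in>J. g j (x (h j))) *\<^sub>R c)"
  using assms
proof (induction k arbitrary: J c)
  case (Suc k)
  show ?case unfolding deg_le.simps
  proof (intro allI)
    fix i y z
    show "deg_le k (\<lambda>x. (\<Prod>j\<in>J. g j ((x(i := y)) (h j))) *\<^sub>R c - (\<Prod>j\<in>J. g j ((x(i := z)) (h j))) *\<^sub>R c)"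
    proof (cases "i \<in> h ` J")
      case True
      then obtain l where l: "l \<in> J" "i = h l" by auto
      have *: "(\<Prod>j\<in>J. g j ((x(i := y)) (h j))) = g l y * (\<Prod>j\<in>J - {l}. g j (x (h j)))" for x y
      proof -
        have "h j \<noteq> i" if "j \<in> J - {l}" for j
          using that Suc.prems(3) l by (auto simp: inj_on_def)
        then show ?thesis
          using Suc.prems l by (subst prod.remove[of _ l]) auto
      qed
      have "deg_le k (\<lambda>x. (\<Prod>j\<in>J - {l}. g j (x (h j))) *\<^sub>R ((g l y - g l z) *\<^sub>R c))"
        using Suc.prems l by (intro Suc.IH) (auto intro: inj_on_subset)
      then show ?thesis unfolding * by (simp add: algebra_simps)
    next
      case False
      then have "(\<Prod>j\<in>J. g j ((x(i := y)) (h j))) = (\<Prod>j\<in>J. g j (x (h j)))" for x y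
        by (intro prod.cong) auto
      then show ?thesis by (simp add: deg_le_const)
    qed
  qed
qed auto

section \<open>Hypercontractivity\<close>

lemma fourth_power_add_le: "(a + b)^4 \<le> a^4 + 4 * (a^3 * b) + 8 * (a\<^sup>2 * b\<^sup>2) + 3 * b^4" for a b :: real
proof -
  \<comment> \<open>The mixed term \<open>4 a b\<^sup>3\<close> is absorbed by \<open>2 a\<^sup>2 b\<^sup>2 + 2 b\<^sup>4\<close>.\<close>
  have "0 \<le> 2 * (b\<^sup>2 * (a - b)\<^sup>2)" by simp
  then show ?thesis by (simp add: power2_eq_square power3_eq_cube power4_eq_xxxx algebra_simps)
qed

text \<open>Bonami's lemma for a uniform finite product space. Split off one coordinate: \<open>F = A + B\<close>, where \<open>A\<close>
  is the mean over that coordinate and \<open>B\<close> has mean zero and degree one less in the others. In the fourth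
  moment the term \<open>A\<^sup>3 B\<close> averages out; the smaller degree of \<open>B\<close> gains a factor that pays for
  the numerical constants in the terms \<open>A\<^sup>2 B\<^sup>2\<close> and \<open>B\<^sup>4\<close>.\<close>

lemma hypercontractive:
  fixes F :: "('i \<Rightarrow> 's) \<Rightarrow> real"
  assumes "finite I" "finite S" "S \<noteq> {}" "deg_le k F"
  shows "avg (PiE I (\<lambda>_. S)) (\<lambda>x. (F x)^4) \<le> (16 * (real (card S))\<^sup>2)^k * (avg (PiE I (\<lambda>_. S)) (\<lambda>x. (F x)\<^sup>2))\<^sup>2"
  using assms(1,4)
proof (induction I arbitrary: k F rule: finite_induct)
  case empty
  have "1 \<le> real (card S)" using assms by (simp add: Suc_leI card_gt_0_iff)
  then have "1 \<le> (real (card S))\<^sup>2" by simp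
  then have "1 \<le> (16 * (real (card S))\<^sup>2)^k" by (intro one_le_power) simp
  from mult_right_mono[OF this, of "(F (\<lambda>_. undefined))^4"] show ?case
    by (simp add: avg_def flip: power_mult)
next
  case (insert i I)
  define m where "m = real (card S)"
  define C where "C = 16 * m\<^sup>2"
  \<comment> \<open>\<open>D\<close> is the square root of \<open>C\<close>; one factor of it is gained in the mixed term by Cauchy-Schwarz.\<close>
  define D where "D = 4 * m"
  have m: "1 \<le> m" using assms by (simp add: Suc_leI card_gt_0_iff m_def)
  then have D: "4 \<le> D" and CD: "C = D\<^sup>2" by (auto simp: C_def D_def power2_eq_square)
  have C3: "3 * m \<le> C"
  proof -
    have "m * 3 \<le> m * (16 * m)" using m by (intro mult_left_mono) auto
    then show ?thesis by (simp add: C_def power2_eq_square)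
  qed
  let ?T = "PiE I (\<lambda>_. S)"
  let ?E = "avg ?T"
  have T: "finite ?T" "?T \<noteq> {}" using insert assms by (auto intro!: finite_PiE simp: PiE_eq_empty_iff)
  show ?case
  proof (cases k)
    case 0
    then have "deg_le 0 F" using insert.prems by simp
    then have "\<forall>x y. F x = F y" unfolding deg_le.simps .
    then have "F x = F (\<lambda>_. undefined)" for x by blast
    then obtain c where F: "F = (\<lambda>_. c)" by blast
    have T': "finite (PiE (insert i I) (\<lambda>_. S))" "PiE (insert i I) (\<lambda>_. S) \<noteq> {}"
      using insert assms by (auto intro!: finite_PiE simp: PiE_eq_empty_iff)
    show ?thesis unfolding F by (simp add: \<open>k = 0\<close> avg_const T' flip: power_mult)
  next
    case (Suc l)
    define A where "A x = avg S (\<lambda>y. F (x(i := y)))" for x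
    define B where "B y x = F (x(i := y)) - A x" for x y
    have FAB: "F (x(i := y)) = A x + B y x" for x y by (simp add: B_def)
    have dA: "deg_le k A" unfolding A_def[abs_def] by (intro deg_le_avg deg_le_update insert.prems)
    \<comment> \<open>As a mean of differences, \<open>B y\<close> has lost one degree.\<close>
    have B': "B y = (\<lambda>x. avg S (\<lambda>z. F (x(i := y)) - F (x(i := z))))" for y
      using assms by (simp add: B_def A_def avg_diff avg_const fun_eq_iff)
    have dB: "deg_le l (B y)" for y
      unfolding B' using insert.prems Suc by (intro deg_le_avg) simp
    have B0: "avg S (\<lambda>y. B y x) = 0" for x
      using assms by (simp add: B_def avg_diff avg_const A_def)
    define a where "a = ?E (\<lambda>x. (A x)\<^sup>2)"
    define b where "b y = ?E (\<lambda>x. (B y x)\<^sup>2)" for y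
    have a0: "0 \<le> a" and b0: "0 \<le> b y" for y by (auto simp: a_def b_def intro!: avg_nonneg)
    have avb0: "0 \<le> avg S b" by (intro avg_nonneg b0)
    have A4: "?E (\<lambda>x. (A x)^4) \<le> C^k * a\<^sup>2"
      using insert.IH[OF dA] by (simp add: C_def m_def a_def)
    have B4: "?E (\<lambda>x. (B y x)^4) \<le> C^l * (b y)\<^sup>2" for y
      using insert.IH[OF dB] by (simp add: C_def m_def b_def)
    have AB: "?E (\<lambda>x. (A x)\<^sup>2 * (B y x)\<^sup>2) \<le> C^l * D * a * b y" for y
    proof (rule power2_le_imp_le)
      have "(?E (\<lambda>x. (A x)\<^sup>2 * (B y x)\<^sup>2))\<^sup>2 \<le> ?E (\<lambda>x. (A x)^4) * ?E (\<lambda>x. (B y x)^4)"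
        using avg_Cauchy_Schwarz[of ?T "\<lambda>x. (A x)\<^sup>2" "\<lambda>x. (B y x)\<^sup>2"] by (simp flip: power_mult)
      also have "\<dots> \<le> (C^k * a\<^sup>2) * (C^l * (b y)\<^sup>2)"
        using A4 B4 by (intro mult_mono) (auto simp: C_def intro!: avg_nonneg)
      also have "\<dots> = (C^l * D * a * b y)\<^sup>2"
        by (simp add: Suc CD power2_eq_square mult_ac)
      finally show "(?E (\<lambda>x. (A x)\<^sup>2 * (B y x)\<^sup>2))\<^sup>2 \<le> (C^l * D * a * b y)\<^sup>2" .
      show "0 \<le> C^l * D * a * b y" using a0 b0 D by (simp add: C_def)
    qed
    have second: "avg (PiE (insert i I) (\<lambda>_. S)) (\<lambda>x. (F x)\<^sup>2) = a + avg S b"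
    proof -
      have "avg (PiE (insert i I) (\<lambda>_. S)) (\<lambda>x. (F x)\<^sup>2)
          = avg S (\<lambda>y. ?E (\<lambda>x. (A x)\<^sup>2) + ?E (\<lambda>x. 2 * A x * B y x) + ?E (\<lambda>x. (B y x)\<^sup>2))"
        by (subst avg_PiE_insert[OF insert.hyps])
          (simp add: FAB power2_sum algebra_simps flip: avg_add)
      also have "\<dots> = a + avg S (\<lambda>y. ?E (\<lambda>x. 2 * A x * B y x)) + avg S b"
        using assms by (simp add: avg_add a_def b_def[abs_def] avg_const)
      also have "avg S (\<lambda>y. ?E (\<lambda>x. 2 * A x * B y x)) = ?E (\<lambda>x. 2 * A x * avg S (\<lambda>y. B y x))"
        by (subst avg_swap) (simp add: avg_mult_left)
      finally show ?thesis using T by (simp add: B0 avg_const)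
    qed
    have "avg (PiE (insert i I) (\<lambda>_. S)) (\<lambda>x. (F x)^4)
        = avg S (\<lambda>y. ?E (\<lambda>x. (A x + B y x)^4))"
      by (subst avg_PiE_insert[OF insert.hyps]) (simp add: FAB)
    also have "\<dots> \<le> avg S (\<lambda>y. ?E (\<lambda>x. (A x)^4 + 4 * ((A x)^3 * B y x) + 8 * ((A x)\<^sup>2 * (B y x)\<^sup>2) + 3 * (B y x)^4))"
      by (intro avg_mono fourth_power_add_le)
    also have "\<dots> = ?E (\<lambda>x. (A x)^4) + 4 * avg S (\<lambda>y. ?E (\<lambda>x. (A x)^3 * B y x))
        + 8 * avg S (\<lambda>y. ?E (\<lambda>x. (A x)\<^sup>2 * (B y x)\<^sup>2)) + 3 * avg S (\<lambda>y. ?E (\<lambda>x. (B y x)^4))"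
      using assms by (simp add: avg_add avg_mult_left avg_const)
    also have "avg S (\<lambda>y. ?E (\<lambda>x. (A x)^3 * B y x)) = 0"
      using T by (subst avg_swap) (simp add: avg_mult_left B0 avg_const)
    also have "avg S (\<lambda>y. ?E (\<lambda>x. (A x)\<^sup>2 * (B y x)\<^sup>2)) \<le> avg S (\<lambda>y. C^l * D * a * b y)"
      by (intro avg_mono AB)
    also have "\<dots> = C^l * D * a * avg S b" by (simp add: avg_mult_left)
    also have "avg S (\<lambda>y. ?E (\<lambda>x. (B y x)^4)) \<le> avg S (\<lambda>y. C^l * (b y)\<^sup>2)"
      by (intro avg_mono B4)
    also have "\<dots> \<le> C^l * (m * (avg S b)\<^sup>2)"
      unfolding avg_mult_left m_def using assms b0
      by (intro mult_left_mono avg_of_squares_le) (auto simp: C_def)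
    finally have "avg (PiE (insert i I) (\<lambda>_. S)) (\<lambda>x. (F x)^4)
        \<le> C^k * a\<^sup>2 + 8 * (C^l * D * a * avg S b) + 3 * (C^l * (m * (avg S b)\<^sup>2))"
      using A4 by linarith
    also have "\<dots> \<le> C^l * (C * (a + avg S b)\<^sup>2)"
    proof -
      have "0 \<le> (C - 3 * m) * (avg S b)\<^sup>2" using C3 by simp
      moreover have "0 \<le> 2 * (D - 4) * D * (a * avg S b)" using D a0 avb0 by simp
      ultimately have "C * a\<^sup>2 + 8 * (D * a * avg S b) + 3 * (m * (avg S b)\<^sup>2) \<le> C * (a + avg S b)\<^sup>2"
        by (simp add: power2_eq_square algebra_simps CD)
      from mult_left_mono[OF this, of "C^l"] show ?thesis
        by (simp add: Suc algebra_simps C_def)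
    qed
    finally show ?thesis by (simp add: second C_def m_def Suc mult_ac)
  qed
qed

section \<open>Norming functionals\<close>

locale seminorm_on =
  fixes V :: "'e::real_vector set" and N :: "'e \<Rightarrow> real"
  assumes subspace: "subspace V"
    and nonneg: "x \<in> V \<Longrightarrow> 0 \<le> N x"
    and scale: "x \<in> V \<Longrightarrow> N (a *\<^sub>R x) = \<bar>a\<bar> * N x"
    and triangle: "x \<in> V \<Longrightarrow> y \<in> V \<Longrightarrow> N (x + y) \<le> N x + N y"
begin

lemma zero: "N 0 = 0"
  using scale[of 0 0] subspace by (simp add: subspace_0)

lemma minus: "x \<in> V \<Longrightarrow> N (- x) = N x"
  using scale[of x "-1"] by simp

lemma sum_le: "(\<And>a. a \<in> A \<Longrightarrow> x a \<in> V) \<Longrightarrow> N (\<Sum>a\<in>A. x a) \<le> (\<Sum>a\<in>A. N (x a))"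
proof (induction A rule: infinite_finite_induct)
  case (insert a A)
  then have "N (x a + (\<Sum>a\<in>A. x a)) \<le> N (x a) + N (\<Sum>a\<in>A. x a)"
    using subspace by (intro triangle subspace_sum) auto
  with insert show ?case by auto
qed (auto simp: zero)

lemma diff_le: "x \<in> V \<Longrightarrow> y \<in> V \<Longrightarrow> N x - N y \<le> N (x - y)"
  using triangle[of "x - y" y] subspace by (simp add: subspace_diff)

text \<open>The extension step of the Hahn-Banach theorem: the value \<open>\<alpha>\<close> at the new vector \<open>b\<close> has to lie between
  all \<open>\<phi> x - N (x - b)\<close> and all \<open>N (y + b) - \<phi> y\<close>, and the triangle inequality leaves room for it.\<close>

lemma functional_extension_step:
  assumes W: "subspace W" "W \<subseteq> V" and b: "b \<in> V"
    and phi: "linear \<phi>" "\<And>x. x \<in> W \<Longrightarrow> \<phi> x \<le> N x"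
  obtains \<phi>' where "linear \<phi>'" "\<And>x. x \<in> W \<Longrightarrow> \<phi>' x = (\<phi> x :: real)"
    "\<And>x. x \<in> span (insert b W) \<Longrightarrow> \<phi>' x \<le> N x"
proof (cases "b \<in> W")
  case True
  then have "span (insert b W) = W" using W by (simp add: insert_absorb span_eq_iff)
  with phi that show ?thesis by metis
next
  case False
  obtain B where B: "B \<subseteq> W" "independent B" "W \<subseteq> span B"
    using maximal_independent_subset by blast
  have spB: "span B = W" using B W by (meson span_minimal subset_antisym)
  have "independent (insert b B)" using B False spB by (simp add: independent_insert)
  then obtain \<psi> where \<psi>: "linear \<psi>" "\<forall>x\<in>insert b B. \<psi> x = (if x = b then 1 else 0 :: real)"
    using linear_independent_extend[of "insert b B" "\<lambda>x. if x = b then 1 else 0"] by auto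
  have \<psi>0: "\<psi> x = 0" if "x \<in> W" for x
  proof -
    have "\<psi> y = 0" if "y \<in> B" for y using that \<psi>(2) False B by auto
    then show ?thesis using linear_eq_0_on_span[OF \<psi>(1), of B x] spB that by simp
  qed
  define \<alpha> where "\<alpha> = (SUP x\<in>W. \<phi> x - N (x - b))"
  \<comment> \<open>The lower bounds for \<open>\<alpha>\<close> lie below the upper bounds.\<close>
  have cross: "\<phi> x - N (x - b) \<le> N (y + b) - \<phi> y" if "x \<in> W" "y \<in> W" for x y
  proof -
    have "\<phi> x + \<phi> y = \<phi> (x + y)" using phi by (simp add: linear_add)
    also have "\<dots> \<le> N ((x - b) + (y + b))" using phi that W by (simp add: subspace_add)
    also have "\<dots> \<le> N (x - b) + N (y + b)"
      using that W b by (intro triangle subspace_add subspace_diff subspace) auto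
    finally show ?thesis by simp
  qed
  have W0: "0 \<in> W" using W by (simp add: subspace_0)
  have "bdd_above ((\<lambda>x. \<phi> x - N (x - b)) ` W)"
    using cross[OF _ W0] by (auto intro!: bdd_aboveI2)
  then have lo: "\<phi> x - N (x - b) \<le> \<alpha>" if "x \<in> W" for x
    unfolding \<alpha>_def using that by (intro cSUP_upper)
  have hi: "\<alpha> \<le> N (y + b) - \<phi> y" if "y \<in> W" for y
    unfolding \<alpha>_def using that W0 cross by (intro cSUP_least) auto
  \<comment> \<open>\<open>\<psi>\<close> vanishes on \<open>W\<close> and equals 1 at \<open>b\<close>, so this correction changes only the value at \<open>b\<close>.\<close>
  define \<phi>' where "\<phi>' x = \<phi> x + (\<alpha> - \<phi> b) * \<psi> x" for x
  have lin: "linear \<phi>'"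
    using phi(1) \<psi>(1) by (simp add: \<phi>'_def linear_iff algebra_simps)
  moreover have eq: "\<phi>' x = \<phi> x" if "x \<in> W" for x using \<psi>0 that by (simp add: \<phi>'_def)
  moreover have "\<phi>' x \<le> N x" if x: "x \<in> span (insert b W)" for x
  proof -
    obtain t where t: "x - t *\<^sub>R b \<in> W"
      using x span_eq_iff[THEN iffD2, OF W(1)] by (auto simp: span_breakdown_eq)
    define w where "w = x - t *\<^sub>R b"
    have \<phi>'b: "\<phi>' b = \<alpha>" using \<psi> by (simp add: \<phi>'_def)
    have xw: "x = w + t *\<^sub>R b" by (simp add: w_def)
    have w: "w \<in> W" using t by (simp add: w_def)
    then have wV: "w \<in> V" using W by auto
    have val: "\<phi>' x = \<phi> w + t * \<alpha>"
      using lin by (simp add: xw linear_add linear_scale \<phi>'b eq w)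
    consider "t = 0" | "t > 0" | "t < 0" by linarith
    then show ?thesis
    proof cases
      case 1
      then show ?thesis using val phi w xw by simp
    next
      case 2
      have "\<alpha> \<le> N ((1 / t) *\<^sub>R w + b) - \<phi> ((1 / t) *\<^sub>R w)"
        by (intro hi subspace_scale W w)
      then have "t * \<alpha> \<le> t * N ((1 / t) *\<^sub>R w + b) - \<phi> w"
        using 2 phi by (simp add: linear_scale field_simps)
      also have "t * N ((1 / t) *\<^sub>R w + b) = N (t *\<^sub>R ((1 / t) *\<^sub>R w + b))"
        using 2 b wV by (subst scale) (auto intro!: subspace_add subspace_scale subspace)
      also have "t *\<^sub>R ((1 / t) *\<^sub>R w + b) = x" using 2 by (simp add: xw scaleR_add_right)
      finally show ?thesis using val by simp
    next
      case 3
      have "\<phi> ((1 / - t) *\<^sub>R w) - N ((1 / - t) *\<^sub>R w - b) \<le> \<alpha>"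
        by (intro lo subspace_scale W w)
      then have "\<phi> w + t * \<alpha> \<le> (- t) * N ((1 / - t) *\<^sub>R w - b)"
        using 3 phi by (simp add: linear_scale linear_neg field_simps)
      also have "\<dots> = N ((- t) *\<^sub>R ((1 / - t) *\<^sub>R w - b))"
        using 3 b wV by (subst scale) (auto intro!: subspace_diff subspace_scale subspace_neg subspace)
      also have "(- t) *\<^sub>R ((1 / - t) *\<^sub>R w - b) = x" using 3 by (simp add: xw scaleR_diff_right)
      finally show ?thesis using val by simp
    qed
  qed
  ultimately show thesis using that by blast
qed

text \<open>The set \<open>B\<close> stands for the finitely many values of a function. Starting from the functional
  \<open>a w \<mapsto> a N(w)\<close> on the line through \<open>w\<close>, the elements of \<open>B\<close> are adjoined one at a time.\<close>

lemma norming_functional: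
  assumes "finite B" "B \<subseteq> V" "w \<in> V"
  obtains \<phi> where "linear \<phi>" "\<phi> w = N w" "\<And>x. x \<in> span (insert w B) \<Longrightarrow> \<bar>\<phi> x\<bar> \<le> N x"
proof -
  have "\<exists>\<phi>. linear \<phi> \<and> \<phi> w = N w \<and> (\<forall>x\<in>span (insert w B). \<phi> x \<le> N x)"
    using assms(1,2)
  proof (induction B rule: finite_induct)
    case empty
    show ?case
    proof (cases "w = 0")
      case True
      have "linear (\<lambda>_ :: 'e. 0 :: real)" by (simp add: linear_iff)
      with True show ?thesis by (intro exI[of _ "\<lambda>_. 0"]) (auto simp: zero)
    next
      case False
      then obtain \<phi> where \<phi>: "linear \<phi>" "\<phi> w = N w"
        using linear_independent_extend[of "{w}" "\<lambda>_. N w"] by auto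
      have "\<phi> x \<le> N x" if x: "x \<in> span {w}" for x
      proof -
        obtain t where "x = t *\<^sub>R w" using x by (auto simp: span_singleton)
        then show ?thesis
          using \<phi> assms(3) by (auto simp: linear_scale scale intro!: mult_right_mono nonneg)
      qed
      with \<phi> show ?thesis by auto
    qed
  next
    case (insert b B)
    then obtain \<phi> where \<phi>: "linear \<phi>" "\<phi> w = N w" "\<And>x. x \<in> span (insert w B) \<Longrightarrow> \<phi> x \<le> N x"
      by auto
    have "span (insert w B) \<subseteq> V"
      using insert.prems assms(3) subspace by (intro span_minimal) auto
    with insert.prems \<phi> obtain \<phi>' where \<phi>': "linear \<phi>'" "\<And>x. x \<in> span (insert w B) \<Longrightarrow> \<phi>' x = \<phi> x"
      "\<And>x. x \<in> span (insert b (span (insert w B))) \<Longrightarrow> \<phi>' x \<le> N x"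
      using functional_extension_step[of "span (insert w B)" b \<phi>] by auto
    have "span (insert w (insert b B)) \<subseteq> span (insert b (span (insert w B)))"
      by (intro span_mono) (auto intro: span_base)
    with \<phi> \<phi>' show ?case
      by (intro exI[of _ \<phi>']) (auto simp: span_base)
  qed
  then obtain \<phi> where \<phi>: "linear \<phi>" "\<phi> w = N w" "\<And>x. x \<in> span (insert w B) \<Longrightarrow> \<phi> x \<le> N x"
    by auto
  have "\<bar>\<phi> x\<bar> \<le> N x" if x: "x \<in> span (insert w B)" for x
  proof -
    have "span (insert w B) \<subseteq> V" using assms subspace by (intro span_minimal) auto
    then have "N (- x) = N x" using x by (intro minus) auto
    with \<phi>(3)[OF x] \<phi>(3)[of "- x"] x linear_neg[OF \<phi>(1)] show ?thesis by (simp add: span_neg)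
  qed
  with \<phi> that show thesis by blast
qed

end

section \<open>Anticoncentration of vector-valued functions of low degree\<close>

text \<open>The set where \<open>F\<^sup>2\<close> is at least a quarter of its mean carries at least three quarters of the second
  moment, so by Cauchy-Schwarz and the bound on the fourth moment it cannot be small. The mean of
  \<open>F\<close> is at most the square root of the second moment.\<close>

lemma Paley_Zygmund:
  fixes F :: "'x \<Rightarrow> real"
  assumes T: "finite T" "T \<noteq> {}"
    and C: "avg T (\<lambda>x. (F x)^4) \<le> C * (avg T (\<lambda>x. (F x)\<^sup>2))\<^sup>2" "1 \<le> C"
  shows "real (card T) \<le> 2 * C * real (card {x\<in>T. \<bar>avg T F\<bar> \<le> 2 * \<bar>F x\<bar>})"
proof -
  define s where "s = avg T (\<lambda>x. (F x)\<^sup>2)"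
  define G where "G = {x\<in>T. s \<le> 4 * (F x)\<^sup>2}"
  define g where "g = avg T (indicat_real G)"
  have s0: "0 \<le> s" by (auto simp: s_def intro!: avg_nonneg)
  have cT: "0 < real (card T)" using T by (simp add: card_gt_0_iff)
  have g: "g = real (card G) / real (card T)"
  proof -
    have "T \<inter> G = G" by (auto simp: G_def)
    then show ?thesis using T by (simp add: g_def avg_def indicator_def sum.If_cases Collect_conj_eq)
  qed
  have main: "1 \<le> 2 * C * g"
  proof (cases "s = 0")
    case True
    then have "G = T" by (auto simp: G_def)
    then show ?thesis using C cT by (simp add: g)
  next
    case False
    have "s = avg T (\<lambda>x. (F x)\<^sup>2)" by (rule s_def)
    also have "\<dots> \<le> avg T (\<lambda>x. s / 4 + (F x)\<^sup>2 * indicator G x)"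
      using s0 by (intro avg_mono) (auto simp: indicator_def G_def)
    also have "\<dots> = s / 4 + avg T (\<lambda>x. (F x)\<^sup>2 * indicator G x)"
      using T by (simp add: avg_add avg_const)
    finally have "3 / 4 * s \<le> avg T (\<lambda>x. (F x)\<^sup>2 * indicator G x)" by simp
    then have "(3 / 4 * s)\<^sup>2 \<le> (avg T (\<lambda>x. (F x)\<^sup>2 * indicator G x))\<^sup>2"
      using s0 by (intro power_mono) auto
    also have "\<dots> \<le> avg T (\<lambda>x. ((F x)\<^sup>2)\<^sup>2) * avg T (\<lambda>x. (indicator G x)\<^sup>2)"
      by (rule avg_Cauchy_Schwarz)
    also have "\<dots> = avg T (\<lambda>x. (F x)^4) * g"
    proof -
      have "(indicator G x)\<^sup>2 = (indicat_real G x)" for x by (simp add: indicator_def)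
      then show ?thesis by (simp add: g_def flip: power_mult)
    qed
    also have "\<dots> \<le> C * s\<^sup>2 * g"
      using C by (intro mult_right_mono) (auto simp: s_def g)
    finally have "9 / 16 * s\<^sup>2 \<le> (C * g) * s\<^sup>2" by (simp add: power_mult_distrib power_divide mult_ac)
    then have "9 / 16 \<le> C * g" using False by (simp only: mult_le_cancel_right) auto
    then show ?thesis by simp
  qed
  have "G \<subseteq> {x\<in>T. \<bar>avg T F\<bar> \<le> 2 * \<bar>F x\<bar>}"
  proof (safe, goal_cases)
    case (2 x)
    then have "(avg T F)\<^sup>2 \<le> (2 * F x)\<^sup>2"
      using avg_square_le[OF T, of F] by (simp add: G_def s_def power_mult_distrib)
    then show ?case using abs_le_square_iff[of "avg T F" "2 * F x"] by (simp add: abs_mult)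
  qed (simp add: G_def)
  then have "real (card G) \<le> real (card {x\<in>T. \<bar>avg T F\<bar> \<le> 2 * \<bar>F x\<bar>})"
    using T by (simp add: card_mono)
  then have "2 * C * real (card G) \<le> 2 * C * real (card {x\<in>T. \<bar>avg T F\<bar> \<le> 2 * \<bar>F x\<bar>})"
    using C by (intro mult_left_mono) auto
  with main cT show ?thesis by (simp add: g field_simps)
qed

text \<open>The reciprocal of the proportion of points guaranteed by the anticoncentration below: twice the
  constant of \<open>hypercontractive\<close> for \<open>m\<close> points in each factor, the 2 bounding the \<open>16 / 9\<close> from
  \<open>Paley_Zygmund\<close>.\<close>

definition hyper_const :: "nat \<Rightarrow> nat \<Rightarrow> real" where
  "hyper_const k m = 2 * (16 * (real m)\<^sup>2)^k"

text \<open>Apply a functional that norms the mean: the values of the functional have low degree, they are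
  dominated by the norms, and their mean is the norm of the mean.\<close>

lemma (in seminorm_on) anticoncentration:
  fixes F :: "('i \<Rightarrow> 's) \<Rightarrow> 'e"
  assumes "finite I" "finite S" "S \<noteq> {}" "deg_le k F" and FV: "\<And>x. F x \<in> V"
  defines "T \<equiv> PiE I (\<lambda>_. S)"
  shows "real (card T) \<le> hyper_const k (card S) * real (card {x\<in>T. N (avg T F) \<le> 2 * N (F x)})"
proof -
  have T: "finite T" "T \<noteq> {}"
    using assms by (auto intro!: finite_PiE simp: PiE_eq_empty_iff T_def)
  have avgV: "avg T F \<in> V"
    unfolding avg_def using subspace FV by (auto intro!: subspace_scale subspace_sum)
  obtain \<phi> where \<phi>: "linear \<phi>" "\<phi> (avg T F) = N (avg T F)"
      "\<And>x. x \<in> span (insert (avg T F) (F ` T)) \<Longrightarrow> \<bar>\<phi> x\<bar> \<le> N x"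
    using norming_functional[of "F ` T" "avg T F"] T(1) FV avgV by blast
  let ?C = "(16 * (real (card S))\<^sup>2)^k"
  have "1 \<le> real (card S)" using assms by (simp add: Suc_leI card_gt_0_iff)
  then have "1 \<le> (real (card S))\<^sup>2" by simp
  then have C: "1 \<le> ?C" by (intro one_le_power) simp
  have "avg T (\<lambda>x. (\<phi> (F x))^4) \<le> ?C * (avg T (\<lambda>x. (\<phi> (F x))\<^sup>2))\<^sup>2"
    unfolding T_def by (intro hypercontractive deg_le_linear[OF \<phi>(1)] assms)
  from Paley_Zygmund[OF T this C]
  have "real (card T) \<le> hyper_const k (card S) * real (card {x\<in>T. \<bar>\<phi> (avg T F)\<bar> \<le> 2 * \<bar>\<phi> (F x)\<bar>})"
    by (simp add: hyper_const_def flip: linear_avg[OF \<phi>(1)])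
  also have "card {x\<in>T. \<bar>\<phi> (avg T F)\<bar> \<le> 2 * \<bar>\<phi> (F x)\<bar>} \<le> card {x\<in>T. N (avg T F) \<le> 2 * N (F x)}"
  proof (rule card_mono)
    have "\<bar>\<phi> (F x)\<bar> \<le> N (F x)" if "x \<in> T" for x
      using that by (intro \<phi>(3) span_base) auto
    then have "2 * \<bar>\<phi> (F x)\<bar> \<le> 2 * N (F x)" if "x \<in> T" for x using that by simp
    moreover have "\<bar>\<phi> (avg T F)\<bar> = N (avg T F)" using nonneg[OF avgV] \<phi>(2) by simp
    ultimately show "{x\<in>T. \<bar>\<phi> (avg T F)\<bar> \<le> 2 * \<bar>\<phi> (F x)\<bar>} \<subseteq> {x\<in>T. N (avg T F) \<le> 2 * N (F x)}"
      by (auto intro: order_trans)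
  qed (use T in auto)
  finally show ?thesis by (simp add: hyper_const_def mult_left_mono)
qed

lemma hyper_const_mono: "m \<le> n \<Longrightarrow> hyper_const k m \<le> hyper_const k n"
  unfolding hyper_const_def by (intro mult_left_mono power_mono) auto

lemma hyper_const_nonneg: "0 \<le> hyper_const k m"
  by (simp add: hyper_const_def)

section \<open>Measurability and law of the norm of a chaos\<close>

text \<open>The ambient vector space carries no topology, so measurability of the norm of a chaos is derived
  from the continuity of the norm as a function of finitely many real coefficients.\<close>

lemma (in seminorm_on) continuous_on_norm_combination:
  assumes "finite L" "\<And>v. v \<in> L \<Longrightarrow> f v \<in> V"
  shows "continuous_on UNIV (\<lambda>x :: 'v \<Rightarrow> real. N (\<Sum>v\<in>L. x v *\<^sub>R f v))"
  unfolding continuous_on_def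
proof
  fix x :: "'v \<Rightarrow> real"
  let ?g = "\<lambda>x. N (\<Sum>v\<in>L. x v *\<^sub>R f v)"
  let ?b = "\<lambda>y. \<Sum>v\<in>L. \<bar>y v - x v\<bar> * N (f v)"
  have V: "(\<Sum>v\<in>L. y v *\<^sub>R f v) \<in> V" for y :: "'v \<Rightarrow> real"
    using assms subspace by (auto intro!: subspace_sum subspace_scale)
  have one_sided: "?g y - ?g z \<le> (\<Sum>v\<in>L. \<bar>y v - z v\<bar> * N (f v))" for y z :: "'v \<Rightarrow> real"
  proof -
    have "?g y - ?g z \<le> N ((\<Sum>v\<in>L. y v *\<^sub>R f v) - (\<Sum>v\<in>L. z v *\<^sub>R f v))"
      by (intro diff_le V)
    also have "\<dots> = N (\<Sum>v\<in>L. (y v - z v) *\<^sub>R f v)"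
      by (simp add: sum_subtractf scaleR_diff_left)
    also have "\<dots> \<le> (\<Sum>v\<in>L. N ((y v - z v) *\<^sub>R f v))"
      using assms subspace by (intro sum_le) (auto intro!: subspace_scale)
    finally show ?thesis using assms by (simp add: scale)
  qed
  have bound: "\<bar>?g y - ?g x\<bar> \<le> ?b y" for y
    using one_sided[of y x] one_sided[of x y] by (simp add: abs_minus_commute)
  have coord: "((\<lambda>y. y v) \<longlongrightarrow> x v) (at x)" for v :: 'v
    using continuous_on_product_coordinates[of v] unfolding continuous_on_def by auto
  have "(?b \<longlongrightarrow> (\<Sum>v\<in>L. \<bar>x v - x v\<bar> * N (f v))) (at x)"
    by (intro tendsto_intros coord)
  then have "(?b \<longlongrightarrow> 0) (at x)" by simp
  then have "((\<lambda>y. ?g y - ?g x) \<longlongrightarrow> 0) (at x)"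
    by (rule Lim_null_comparison[rotated]) (use bound in auto)
  then show "(?g \<longlongrightarrow> ?g x) (at x within UNIV)"
    by (simp add: LIM_zero_iff)
qed

lemma (in seminorm_on) borel_measurable_norm_combination:
  fixes c :: "'v::countable \<Rightarrow> 'm \<Rightarrow> real"
  assumes "finite L" "\<And>v. v \<in> L \<Longrightarrow> f v \<in> V" "\<And>v. v \<in> L \<Longrightarrow> c v \<in> borel_measurable M"
  shows "(\<lambda>\<omega>. N (\<Sum>v\<in>L. c v \<omega> *\<^sub>R f v)) \<in> borel_measurable M"
proof -
  let ?g = "\<lambda>x :: 'v \<Rightarrow> real. N (\<Sum>v\<in>L. x v *\<^sub>R f v)"
  let ?c = "\<lambda>\<omega> v. if v \<in> L then c v \<omega> else 0"
  have "?c \<in> borel_measurable M"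
  proof (intro measurable_coordinatewise_then_product)
    show "(\<lambda>\<omega>. ?c \<omega> v) \<in> borel_measurable M" for v
      using assms by (cases "v \<in> L") auto
  qed
  moreover have "?g \<in> borel_measurable borel"
    using assms by (intro borel_measurable_continuous_onI continuous_on_norm_combination)
  ultimately have "(\<lambda>\<omega>. ?g (?c \<omega>)) \<in> borel_measurable M" by (rule measurable_compose)
  then show ?thesis by (simp cong: sum.cong)
qed

locale chaos = seminorm_on V N for V :: "'e::real_vector set" and N +
  fixes k :: nat and f :: "nat list \<Rightarrow> 'e"
  assumes in_space: "length v = k \<Longrightarrow> f v \<in> V"
    and finite_support: "finitely_supported k f"
    and diagonal_free: "diagonal_free k f"
begin

abbreviation "supp \<equiv> {v. length v = k \<and> f v \<noteq> 0}"

lemma finite_supp: "finite supp"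
  using finite_support by (simp add: finitely_supported_def)

lemma inj_on_nth_supp: "v \<in> supp \<Longrightarrow> inj_on ((!) v) {..<k}"
  using diagonal_free unfolding diagonal_free_def by (intro inj_on_nth) auto

lemma Q_in_space: "Q k f X \<omega> \<in> V"
  unfolding Q_def by (intro subspace_sum subspace subspace_scale) (auto intro: in_space)

lemma Q_cong:
  "(\<And>j v. v \<in> supp \<Longrightarrow> j < k \<Longrightarrow> X j (v ! j) \<omega> = Y j (v ! j) \<omega>') \<Longrightarrow> Q k f X \<omega> = Q k f Y \<omega>'"
  unfolding Q_def by (intro sum.cong refl arg_cong2[where f = scaleR] prod.cong) auto

lemma Q_scale: "Q k f (\<lambda>j i \<omega>. c * X j i \<omega>) \<omega> = c ^ k *\<^sub>R Q k f X \<omega>"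
  by (simp add: Q_def prod.distrib scaleR_sum_right)

lemma borel_measurable_norm_Q [measurable]:
  assumes "\<And>j i. j < k \<Longrightarrow> X j i \<in> borel_measurable M"
  shows "(\<lambda>\<omega>. N (Q k f X \<omega>)) \<in> borel_measurable M"
  unfolding Q_def using assms
  by (intro borel_measurable_norm_combination finite_supp borel_measurable_prod) (auto intro: in_space)

text \<open>Only the marginal laws of independent variables matter. The map \<open>h\<close> tells which variable of the
  family stands in slot \<open>j\<close> at index \<open>i\<close>; this covers both the decoupled chaos (\<open>h j i = (j, i)\<close>)
  and the coupled one (\<open>h j i = i\<close>).\<close>

lemma prob_norm_Q_eq:
  assumes "prob_space M" "P \<noteq> {}"
    and X: "prob_space.indep_vars M (\<lambda>_. borel) X P"
    and X': "prob_space.indep_vars M (\<lambda>_. borel) X' P"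
    and marginals: "\<And>p. p \<in> P \<Longrightarrow> distr M borel (X p) = distr M borel (X' p)"
    and h: "\<And>j i. j < k \<Longrightarrow> h j i \<in> P"
  shows "\<P>(\<omega> in M. t \<le> N (Q k f (\<lambda>j i. X (h j i)) \<omega>)) = \<P>(\<omega> in M. t \<le> N (Q k f (\<lambda>j i. X' (h j i)) \<omega>))"
proof -
  interpret prob_space M by fact
  define D where "D = (PiM P (\<lambda>_. borel) :: ('b \<Rightarrow> real) measure)"
  define G where "G = {x \<in> space D. t \<le> N (Q k f (\<lambda>j i x. x (h j i)) x)}"
  have "(\<lambda>x. N (Q k f (\<lambda>j i x. x (h j i)) x)) \<in> borel_measurable D"
    unfolding D_def using h by (intro borel_measurable_norm_Q measurable_component_singleton)
  then have G: "G \<in> sets D" unfolding G_def by measurable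
  have law: "measure (PiM P (\<lambda>p. distr M borel (Y p))) G = \<P>(\<omega> in M. t \<le> N (Q k f (\<lambda>j i. Y (h j i)) \<omega>))"
    if Y: "indep_vars (\<lambda>_. borel) Y P" for Y
  proof -
    have rv: "Y p \<in> borel_measurable M" if "p \<in> P" for p
      using Y that by (auto simp: indep_vars_def)
    then have meas: "(\<lambda>\<omega>. \<lambda>p\<in>P. Y p \<omega>) \<in> measurable M D" unfolding D_def by (intro measurable_restrict)
    have "PiM P (\<lambda>p. distr M borel (Y p)) = distr M D (\<lambda>\<omega>. \<lambda>p\<in>P. Y p \<omega>)"
      using Y indep_vars_iff_distr_eq_PiM'[OF \<open>P \<noteq> {}\<close>, where M' = "\<lambda>_. borel" and X = Y] rv by (simp add: D_def)
    then have "measure (PiM P (\<lambda>p. distr M borel (Y p))) G = prob ((\<lambda>\<omega>. \<lambda>p\<in>P. Y p \<omega>) -` G \<inter> space M)"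
      using meas G by (simp add: measure_distr)
    also have "(\<lambda>\<omega>. \<lambda>p\<in>P. Y p \<omega>) -` G \<inter> space M = {\<omega>\<in>space M. t \<le> N (Q k f (\<lambda>j i. Y (h j i)) \<omega>)}"
    proof -
      have "Q k f (\<lambda>j i x. x (h j i)) (\<lambda>p\<in>P. Y p \<omega>) = Q k f (\<lambda>j i. Y (h j i)) \<omega>" for \<omega>
        using h by (intro Q_cong) simp
      then show ?thesis using measurable_space[OF meas] by (auto simp: G_def)
    qed
    finally show ?thesis .
  qed
  have "PiM P (\<lambda>p. distr M borel (X p)) = PiM P (\<lambda>p. distr M borel (X' p))"
    using marginals by (intro PiM_cong) auto
  with law[OF X] law[OF X'] show ?thesis by simp
qed

text \<open>The principle behind both inequalities. For each sample point, if the chaos of the averaged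
  variables has norm at least \<open>2 t\<close>, then by anticoncentration a fixed proportion of the choices
  \<open>\<tau>\<close> give a chaos of norm at least \<open>t\<close>. Summing over the choices and integrating over the sample
  points bounds the probability of the former by that of the latter.\<close>

lemma randomized_choice:
  fixes Y :: "nat \<Rightarrow> nat \<Rightarrow> 's \<Rightarrow> 'm \<Rightarrow> real"
  assumes "prob_space M" and S: "finite S" "S \<noteq> {}"
    and Y: "\<And>j i s. j < k \<Longrightarrow> s \<in> S \<Longrightarrow> Y j i s \<in> borel_measurable M"
    and p: "\<And>\<tau>. (\<And>i. \<tau> i \<in> S) \<Longrightarrow> \<P>(\<omega> in M. t \<le> N (Q k f (\<lambda>j i. Y j i (\<tau> i)) \<omega>)) \<le> p"
  shows "\<P>(\<omega> in M. 2 * t \<le> N (Q k f (\<lambda>j i \<omega>. avg S (\<lambda>s. Y j i s \<omega>)) \<omega>)) \<le> hyper_const k (card S) * p"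
proof -
  interpret prob_space M by fact
  define I where "I = (\<Union>v\<in>supp. set v)"
  define T where "T = PiE I (\<lambda>_. S)"
  define F where "F \<tau> \<omega> = Q k f (\<lambda>j i. Y j i (\<tau> i)) \<omega>" for \<tau> \<omega>
  define E where "E \<tau> = {\<omega>\<in>space M. t \<le> N (F \<tau> \<omega>)}" for \<tau>
  define G where "G = {\<omega>\<in>space M. 2 * t \<le> N (Q k f (\<lambda>j i \<omega>. avg S (\<lambda>s. Y j i s \<omega>)) \<omega>)}"
  let ?K = "hyper_const k (card S)"
  have K: "0 \<le> ?K" by (simp add: hyper_const_def)
  have I: "finite I" unfolding I_def using finite_supp by auto
  have T: "finite T" "T \<noteq> {}"
    using I S by (auto intro!: finite_PiE simp: PiE_eq_empty_iff T_def)
  have deg: "deg_le k (\<lambda>\<tau>. F \<tau> \<omega>)" for \<omega>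
    unfolding F_def Q_def using inj_on_nth_supp
    by (intro deg_le_sum deg_le_monomial[where g = "\<lambda>j s. Y j (_ ! j) s \<omega>"]) auto
  have avgF: "avg T (\<lambda>\<tau>. F \<tau> \<omega>) = Q k f (\<lambda>j i \<omega>. avg S (\<lambda>s. Y j i s \<omega>)) \<omega>" for \<omega>
  proof -
    have "avg T (\<lambda>\<tau>. \<Prod>j<k. Y j (v ! j) (\<tau> (v ! j)) \<omega>) = (\<Prod>j<k. avg S (\<lambda>s. Y j (v ! j) s \<omega>))"
      if "v \<in> supp" for v
      unfolding T_def using inj_on_nth_supp[OF that] I S that
      by (intro avg_PiE_monomial[where g = "\<lambda>j s. Y j (v ! j) s \<omega>"]) (auto simp: I_def)
    then show ?thesis
      unfolding F_def Q_def by (simp add: avg_sum avg_scaleR)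
  qed
  have E: "E \<tau> \<in> events \<and> prob (E \<tau>) \<le> p" if "\<tau> \<in> T" for \<tau>
  proof -
    \<comment> \<open>Elements of \<open>T\<close> are undefined outside \<open>I\<close>; extend them by an arbitrary admissible choice.\<close>
    obtain s where s: "s \<in> S" using S by auto
    define \<sigma> where "\<sigma> i = (if i \<in> I then \<tau> i else s)" for i
    have \<sigma>: "\<sigma> i \<in> S" for i using that s by (auto simp: \<sigma>_def T_def)
    have "F \<tau> \<omega> = Q k f (\<lambda>j i. Y j i (\<sigma> i)) \<omega>" for \<omega>
      unfolding F_def by (intro Q_cong) (auto simp: \<sigma>_def I_def)
    then have E_eq: "E \<tau> = {\<omega>\<in>space M. t \<le> N (Q k f (\<lambda>j i. Y j i (\<sigma> i)) \<omega>)}"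
      by (simp add: E_def)
    have "(\<lambda>\<omega>. N (Q k f (\<lambda>j i. Y j i (\<sigma> i)) \<omega>)) \<in> borel_measurable M"
      using Y \<sigma> by (intro borel_measurable_norm_Q) auto
    then show ?thesis using p[OF \<sigma>] unfolding E_eq by simp
  qed
  have G: "G \<in> events"
  proof -
    have "(\<lambda>\<omega>. N (Q k f (\<lambda>j i \<omega>. avg S (\<lambda>s. Y j i s \<omega>)) \<omega>)) \<in> borel_measurable M"
      unfolding avg_def using Y by (intro borel_measurable_norm_Q) auto
    then show ?thesis unfolding G_def by measurable
  qed
  have "real (card T) * indicat_real G \<omega> \<le> ?K * (\<Sum>\<tau>\<in>T. indicat_real (E \<tau>) \<omega>)" if "\<omega> \<in> space M" for \<omega>
  proof (cases "\<omega> \<in> G")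
    case True
    have "real (card T) \<le> ?K * real (card {\<tau>\<in>T. N (avg T (\<lambda>\<tau>. F \<tau> \<omega>)) \<le> 2 * N (F \<tau> \<omega>)})"
      unfolding T_def using I S deg by (intro anticoncentration) (auto simp: F_def Q_in_space)
    also have "\<dots> \<le> ?K * real (card {\<tau>\<in>T. \<omega> \<in> E \<tau>})"
      using True that T K unfolding avgF
      by (intro mult_left_mono of_nat_mono card_mono) (auto simp: E_def G_def)
    also have "real (card {\<tau>\<in>T. \<omega> \<in> E \<tau>}) = (\<Sum>\<tau>\<in>T. indicat_real (E \<tau>) \<omega>)"
      using T by (simp add: indicator_def sum.If_cases Collect_conj_eq)
    finally show ?thesis using True by simp
  qed (use K in \<open>auto intro!: mult_nonneg_nonneg sum_nonneg\<close>)
  then have "(\<integral>\<omega>. real (card T) * indicat_real G \<omega> \<partial>M) \<le> (\<integral>\<omega>. ?K * (\<Sum>\<tau>\<in>T. indicat_real (E \<tau>) \<omega>) \<partial>M)"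
    using E G by (intro integral_mono) (auto simp: emeasure_eq_measure)
  also have "\<dots> = ?K * (\<Sum>\<tau>\<in>T. prob (E \<tau>))"
    using E by (simp add: emeasure_eq_measure)
  also have "\<dots> \<le> ?K * (\<Sum>\<tau>\<in>T. p)"
    using K E by (intro mult_left_mono sum_mono) auto
  finally have "real (card T) * prob G \<le> real (card T) * (?K * p)"
    using G by (simp add: mult_ac)
  moreover have "0 < real (card T)" using T by (simp add: card_gt_0_iff)
  ultimately have "prob G \<le> ?K * p" by simp
  then show ?thesis by (simp add: G_def)
qed

end

section \<open>Polarization\<close>

text \<open>Inclusion-exclusion: expand \<open>\<Prod>a\<in>K. (1 - [a \<notin> R])\<close>.\<close>

lemma sum_cover_signs:
  assumes "finite K" "R \<subseteq> K"
  shows "(\<Sum>A\<in>Pow K. (-1) ^ (card K - card A) * (if R \<subseteq> A then 1 else 0)) = (if R = K then 1 else 0 :: real)"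
proof -
  let ?h = "\<lambda>a. if a \<in> R then 0 else 1 :: real"
  have "(\<Sum>A\<in>Pow K. (-1) ^ (card K - card A) * (if R \<subseteq> A then 1 else 0 :: real))
      = (\<Sum>A\<in>Pow K. (-1) ^ (card K - card A) * (\<Prod>a\<in>A. 1) * (\<Prod>a\<in>K - A. ?h a))"
  proof (intro sum.cong refl)
    fix A assume "A \<in> Pow K"
    then have "finite (K - A)" using assms by auto
    then have "(\<Prod>a\<in>K - A. ?h a) = (if R \<subseteq> A then 1 else 0)"
      using assms by (auto simp: prod_zero_iff intro!: prod.neutral)
    then show "(-1) ^ (card K - card A) * (if R \<subseteq> A then 1 else 0 :: real)
        = (-1) ^ (card K - card A) * (\<Prod>a\<in>A. 1) * (\<Prod>a\<in>K - A. ?h a)" by simp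
  qed
  also have "\<dots> = (\<Prod>a\<in>K. 1 - ?h a)"
    using prod_diff_conv_sum'[of K "\<lambda>_. 1" ?h] assms by simp
  also have "\<dots> = (if R = K then 1 else 0)"
    using assms by (auto intro!: prod.neutral)
  finally show ?thesis .
qed

lemma sum_permutes_eq_sum_surj:
  "(\<Sum>\<sigma> | \<sigma> permutes K. G (restrict \<sigma> K)) = (\<Sum>g | g \<in> K \<rightarrow>\<^sub>E K \<and> g ` K = K. G g)"
  if "finite K"
proof (rule sum.reindex_bij_witness[where j = "\<lambda>\<sigma>. restrict \<sigma> K" and i = "\<lambda>g x. if x \<in> K then g x else x"])
  fix g assume g: "g \<in> {g \<in> K \<rightarrow>\<^sub>E K. g ` K = K}"
  then have "inj_on g K" using that by (simp add: eq_card_imp_inj_on)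
  with g have "bij_betw (\<lambda>x. if x \<in> K then g x else x) K K"
    by (auto simp: bij_betw_def inj_on_def)
  then show "(\<lambda>x. if x \<in> K then g x else x) \<in> {\<sigma>. \<sigma> permutes K}"
    by (auto intro!: bij_imp_permutes)
  show "restrict (\<lambda>x. if x \<in> K then g x else x) K = g"
    using g by (auto simp: fun_eq_iff PiE_def extensional_def)
next
  fix \<sigma> assume "\<sigma> \<in> {\<sigma>. \<sigma> permutes K}"
  then have \<sigma>: "\<sigma> permutes K" by simp
  show "(\<lambda>x. if x \<in> K then restrict \<sigma> K x else x) = \<sigma>"
    using \<sigma> by (auto simp: fun_eq_iff permutes_def)
  show "restrict \<sigma> K \<in> {g \<in> K \<rightarrow>\<^sub>E K. g ` K = K}"
    using \<sigma> by (auto simp: permutes_in_image permutes_image)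
qed auto

text \<open>Expanding the products gives all maps \<open>g\<close> from \<open>K\<close> to itself, each weighted by the signed number of the sets
  \<open>A\<close> containing its image; only surjective maps, that is permutations, survive.\<close>

lemma polarization:
  fixes x :: "'a \<Rightarrow> 'a \<Rightarrow> real"
  assumes "finite K"
  shows "(\<Sum>A\<in>Pow K. (-1) ^ (card K - card A) * (\<Prod>j\<in>K. \<Sum>a\<in>A. x a j)) = (\<Sum>\<sigma> | \<sigma> permutes K. \<Prod>j\<in>K. x (\<sigma> j) j)"
proof -
  let ?G = "\<lambda>g. \<Prod>j\<in>K. x (g j) j"
  have expand: "(\<Prod>j\<in>K. \<Sum>a\<in>A. x a j) = (\<Sum>g\<in>K \<rightarrow>\<^sub>E K. (if g ` K \<subseteq> A then 1 else 0) * ?G g)"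
    if "A \<in> Pow K" for A
  proof -
    have fin: "finite A" using that assms finite_subset by auto
    have "(\<Prod>j\<in>K. \<Sum>a\<in>A. x a j) = (\<Sum>g\<in>K \<rightarrow>\<^sub>E A. ?G g)"
      using assms fin by (simp add: prod_sum_PiE)
    also have "\<dots> = (\<Sum>g\<in>K \<rightarrow>\<^sub>E A. (if g ` K \<subseteq> A then 1 else 0) * ?G g)"
      by (intro sum.cong) auto
    also have "\<dots> = (\<Sum>g\<in>K \<rightarrow>\<^sub>E K. (if g ` K \<subseteq> A then 1 else 0) * ?G g)"
      using that assms by (intro sum.mono_neutral_left) (auto intro!: finite_PiE PiE_I)
    finally show ?thesis .
  qed
  have "(\<Sum>A\<in>Pow K. (-1) ^ (card K - card A) * (\<Prod>j\<in>K. \<Sum>a\<in>A. x a j))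
      = (\<Sum>A\<in>Pow K. \<Sum>g\<in>K \<rightarrow>\<^sub>E K. (-1) ^ (card K - card A) * (if g ` K \<subseteq> A then 1 else 0) * ?G g)"
    by (intro sum.cong refl) (simp only: expand sum_distrib_left mult.assoc)
  also have "\<dots> = (\<Sum>g\<in>K \<rightarrow>\<^sub>E K. (\<Sum>A\<in>Pow K. (-1) ^ (card K - card A) * (if g ` K \<subseteq> A then 1 else 0)) * ?G g)"
    by (subst sum.swap) (simp only: sum_distrib_right)
  also have "\<dots> = (\<Sum>g\<in>K \<rightarrow>\<^sub>E K. if g ` K = K then ?G g else 0)"
  proof (intro sum.cong refl)
    fix g assume "g \<in> K \<rightarrow>\<^sub>E K"
    then have "g ` K \<subseteq> K" by auto
    from sum_cover_signs[OF assms this]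
    show "(\<Sum>A\<in>Pow K. (-1) ^ (card K - card A) * (if g ` K \<subseteq> A then 1 else 0)) * ?G g
        = (if g ` K = K then ?G g else 0)" by simp
  qed
  also have "\<dots> = (\<Sum>g | g \<in> K \<rightarrow>\<^sub>E K \<and> g ` K = K. ?G g)"
    using assms by (subst sum.inter_filter) (auto intro!: finite_PiE)
  also have "\<dots> = (\<Sum>\<sigma> | \<sigma> permutes K. ?G (restrict \<sigma> K))"
    by (rule sum_permutes_eq_sum_surj[OF assms, of ?G, symmetric])
  finally show ?thesis by simp
qed

lemma Q_eq_sum_superset:
  assumes "finite L" "\<And>v. v \<in> L \<Longrightarrow> length v = k" "\<And>v. length v = k \<Longrightarrow> f v \<noteq> 0 \<Longrightarrow> v \<in> L"
  shows "Q k f X \<omega> = (\<Sum>v\<in>L. (\<Prod>j<k. X j (v ! j) \<omega>) *\<^sub>R f v)"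
  unfolding Q_def using assms by (intro sum.mono_neutral_left) auto

lemma sum_permute_list:
  fixes f :: "nat list \<Rightarrow> 'e::real_vector"
  assumes \<sigma>: "\<sigma> permutes {..<k}"
  shows "(\<Sum>v | set v \<subseteq> I \<and> length v = k. (\<Prod>j<k. x j (v ! j)) *\<^sub>R f (permute_list \<sigma> v))
       = (\<Sum>v | set v \<subseteq> I \<and> length v = k. (\<Prod>j<k. x (\<sigma> j) (v ! j) :: real) *\<^sub>R f v)"
proof (rule sum.reindex_bij_witness[where j = "permute_list \<sigma>" and i = "permute_list (inv \<sigma>)"])
  fix v assume "v \<in> {v. set v \<subseteq> I \<and> length v = k}"
  then have v: "set v \<subseteq> I" "length v = k" by auto
  have \<sigma>v: "\<sigma> permutes {..<length v}" and inv: "inv \<sigma> permutes {..<length v}"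
    using \<sigma> v permutes_inv by auto
  show "permute_list (inv \<sigma>) (permute_list \<sigma> v) = v"
    using permute_list_compose[OF inv, of \<sigma>] \<sigma> by (simp add: permutes_inv_o)
  show "permute_list \<sigma> (permute_list (inv \<sigma>) v) = v"
    using permute_list_compose[OF \<sigma>v, of "inv \<sigma>"] \<sigma> by (simp add: permutes_inv_o)
  show "permute_list \<sigma> v \<in> {v. set v \<subseteq> I \<and> length v = k}"
    "permute_list (inv \<sigma>) v \<in> {v. set v \<subseteq> I \<and> length v = k}"
    using v \<sigma>v inv by auto
  have "(\<Prod>j<k. x (\<sigma> j) (permute_list \<sigma> v ! j)) = (\<Prod>j<k. x (\<sigma> j) (v ! \<sigma> j))"
    using \<sigma>v v by (intro prod.cong) (auto simp: permute_list_nth)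
  also have "\<dots> = (\<Prod>j<k. x j (v ! j))"
    by (rule prod.permute[OF \<sigma>, of "\<lambda>j. x j (v ! j)", symmetric, unfolded comp_def])
  finally show "(\<Prod>j<k. x (\<sigma> j) (permute_list \<sigma> v ! j)) *\<^sub>R f (permute_list \<sigma> v)
      = (\<Prod>j<k. x j (v ! j)) *\<^sub>R f (permute_list \<sigma> v)" by simp
qed

lemma Q_symmetrization:
  assumes "finitely_supported k f"
  shows "Q k (symmetrization k f) X \<omega> =
    (1 / fact k) *\<^sub>R (\<Sum>A\<in>Pow {..<k}. (-1) ^ (k - card A) *\<^sub>R Q k f (\<lambda>_ i \<omega>. \<Sum>a\<in>A. X a i \<omega>) \<omega>)"
proof -
  define I where "I = (\<Union>v\<in>{v. length v = k \<and> f v \<noteq> 0}. set v)"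
  define L where "L = {v. set v \<subseteq> I \<and> length v = k}"
  let ?P = "{\<sigma>. \<sigma> permutes {..<k}}"
  have "finite I" using assms by (auto simp: I_def finitely_supported_def)
  then have L: "finite L" unfolding L_def by (rule finite_lists_length_eq)
  have L_supp: "v \<in> L" if "length v = k" "f v \<noteq> 0" for v
    using that by (auto simp: L_def I_def)
  have L_length: "length v = k" if "v \<in> L" for v
    using that by (simp add: L_def)
  have "Q k (symmetrization k f) X \<omega> = (\<Sum>v\<in>L. (\<Prod>j<k. X j (v ! j) \<omega>) *\<^sub>R symmetrization k f v)"
  proof (rule Q_eq_sum_superset[OF L])
    fix v :: "nat list" assume v: "length v = k" "symmetrization k f v \<noteq> 0"
    then obtain \<sigma> where \<sigma>: "\<sigma> permutes {..<k}" "f (permute_list \<sigma> v) \<noteq> 0"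
      unfolding symmetrization_def by (metis (mono_tags, lifting) mem_Collect_eq scaleR_zero_right sum.neutral)
    then have "permute_list \<sigma> v \<in> L" using v by (intro L_supp) auto
    then show "v \<in> L" using v \<sigma> by (simp add: L_def)
  qed (simp add: L_def)
  also have "\<dots> = (1 / fact k) *\<^sub>R (\<Sum>v\<in>L. \<Sum>\<sigma>\<in>?P. (\<Prod>j<k. X j (v ! j) \<omega>) *\<^sub>R f (permute_list \<sigma> v))"
    by (simp add: symmetrization_def scaleR_sum_right mult.commute)
  also have "(\<Sum>v\<in>L. \<Sum>\<sigma>\<in>?P. (\<Prod>j<k. X j (v ! j) \<omega>) *\<^sub>R f (permute_list \<sigma> v))
      = (\<Sum>\<sigma>\<in>?P. \<Sum>v\<in>L. (\<Prod>j<k. X (\<sigma> j) (v ! j) \<omega>) *\<^sub>R f v)"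
    unfolding L_def
    by (subst sum.swap) (intro sum.cong refl sum_permute_list[where x = "\<lambda>j i. X j i \<omega>"], simp)
  also have "\<dots> = (\<Sum>v\<in>L. (\<Sum>\<sigma>\<in>?P. \<Prod>j<k. X (\<sigma> j) (v ! j) \<omega>) *\<^sub>R f v)"
    by (subst sum.swap) (simp add: scaleR_sum_left)
  also have "\<dots> = (\<Sum>v\<in>L. (\<Sum>A\<in>Pow {..<k}. (-1) ^ (k - card A) * (\<Prod>j<k. \<Sum>a\<in>A. X a (v ! j) \<omega>)) *\<^sub>R f v)"
    using polarization[of "{..<k}" "\<lambda>a j. X a (_ ! j) \<omega>"] by simp
  also have "\<dots> = (\<Sum>A\<in>Pow {..<k}. (-1) ^ (k - card A) *\<^sub>R (\<Sum>v\<in>L. (\<Prod>j<k. \<Sum>a\<in>A. X a (v ! j) \<omega>) *\<^sub>R f v))"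
    unfolding scaleR_sum_left by (subst sum.swap) (simp add: scaleR_sum_right)
  also have "\<dots> = (\<Sum>A\<in>Pow {..<k}. (-1) ^ (k - card A) *\<^sub>R Q k f (\<lambda>_ i \<omega>. \<Sum>a\<in>A. X a i \<omega>) \<omega>)"
    by (simp add: Q_eq_sum_superset[OF L _ L_supp] L_length)
  finally show ?thesis .
qed

section \<open>Independence of a double array\<close>

context prob_space
begin

lemma indep_vars_reindex_inj:
  assumes X: "indep_vars (\<lambda>_. N) X I" and h: "inj_on h J" "h ` J \<subseteq> I"
  shows "indep_vars (\<lambda>_. N) (\<lambda>j. X (h j)) J"
proof -
  have "indep_vars (\<lambda>j. PiM {h j} (\<lambda>_. N)) (\<lambda>j \<omega>. restrict (\<lambda>i. X i \<omega>) {h j}) J"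
    using h by (intro indep_vars_restrict[OF X]) (auto simp: disjoint_family_on_def inj_on_def)
  then have "indep_vars (\<lambda>_. N) (\<lambda>j \<omega>. (\<lambda>x. x (h j)) (restrict (\<lambda>i. X i \<omega>) {h j})) J"
    by (rule indep_vars_compose2) auto
  then show ?thesis by simp
qed

text \<open>Independent rows with independent entries form an independent array: a finite intersection of
  events is grouped by rows, and within each row it is a cylinder event of that row.\<close>

lemma indep_vars_Times:
  fixes X :: "'j \<Rightarrow> 'i \<Rightarrow> 'a \<Rightarrow> 'b"
  assumes rows: "indep_vars (\<lambda>_. PiM UNIV (\<lambda>_. N)) (\<lambda>j \<omega> i. X j i \<omega>) A"
    and entries: "\<And>j. j \<in> A \<Longrightarrow> indep_vars (\<lambda>_. N) (X j) UNIV"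
  shows "indep_vars (\<lambda>_. N) (\<lambda>(j, i). X j i) (A \<times> UNIV)"
proof -
  have rv: "X j i \<in> measurable M N" if "j \<in> A" for j i
    using entries[OF that] by (auto simp: indep_vars_def)
  have "indep_sets (\<lambda>p. {(case p of (j, i) \<Rightarrow> X j i) -` B \<inter> space M | B. B \<in> sets N}) (A \<times> UNIV)"
  proof (rule indep_setsI)
    fix E :: "'j \<times> 'i \<Rightarrow> 'a set" and J
    assume J: "J \<noteq> {}" "J \<subseteq> A \<times> UNIV" "finite J"
      and E: "\<forall>p\<in>J. E p \<in> {(case p of (j, i) \<Rightarrow> X j i) -` B \<inter> space M | B. B \<in> sets N}"
    then have "\<forall>p\<in>J. \<exists>b. b \<in> sets N \<and> E p = (case p of (j, i) \<Rightarrow> X j i) -` b \<inter> space M"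
      by blast
    from bchoice[OF this] obtain B where
      "\<forall>p\<in>J. B p \<in> sets N \<and> E p = (case p of (j, i) \<Rightarrow> X j i) -` B p \<inter> space M" ..
    then have B: "\<And>p. p \<in> J \<Longrightarrow> B p \<in> sets N"
        "\<And>j i. (j, i) \<in> J \<Longrightarrow> E (j, i) = X j i -` B (j, i) \<inter> space M"
      by auto
    define J1 where "J1 = fst ` J"
    define J2 where "J2 j = {i. (j, i) \<in> J}" for j
    define C where "C j = {x \<in> space (PiM UNIV (\<lambda>_. N)). \<forall>i\<in>J2 j. x i \<in> B (j, i)}" for j
    have J_Sigma: "J = Sigma J1 J2" by (force simp: J1_def J2_def)
    have J1: "finite J1" "J1 \<noteq> {}" "J1 \<subseteq> A" using J by (auto simp: J1_def)
    have J2: "finite (J2 j)" for j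
    proof -
      have "J2 j \<subseteq> snd ` J" by (force simp: J2_def)
      then show ?thesis using J finite_subset by blast
    qed
    have J2_ne: "J2 j \<noteq> {}" if "j \<in> J1" for j using that by (auto simp: J1_def J2_def)
    have C: "C j \<in> sets (PiM UNIV (\<lambda>_. N))" for j
    proof -
      have "{x \<in> space (PiM UNIV (\<lambda>_. N)). x i \<in> B (j, i)} \<in> sets (PiM UNIV (\<lambda>_. N))" if "i \<in> J2 j" for i
      proof -
        have "B (j, i) \<in> sets N" using that B(1) by (auto simp: J2_def)
        then show ?thesis by measurable
      qed
      then show ?thesis unfolding C_def using J2 by (intro sets.sets_Collect_finite_All)
    qed
    have CX: "(\<lambda>\<omega> i. X j i \<omega>) -` C j \<inter> space M = (\<Inter>i\<in>J2 j. E (j, i))" if "j \<in> J1" for j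
    proof -
      have "(\<lambda>i. X j i \<omega>) \<in> space (PiM UNIV (\<lambda>_. N))" if "\<omega> \<in> space M" for \<omega>
        using measurable_space[OF rv that] \<open>j \<in> J1\<close> J1 by (auto simp: space_PiM)
      then show ?thesis
        using J2_ne[OF that] B(2) by (auto simp: C_def J2_def)
    qed
    have "(\<Inter>p\<in>J. E p) = (\<Inter>j\<in>J1. (\<lambda>\<omega> i. X j i \<omega>) -` C j \<inter> space M)"
    proof -
      have "(\<Inter>p\<in>J. E p) = (\<Inter>j\<in>J1. \<Inter>i\<in>J2 j. E (j, i))" unfolding J_Sigma by blast
      with CX show ?thesis by simp
    qed
    also have "prob \<dots> = (\<Prod>j\<in>J1. prob ((\<lambda>\<omega> i. X j i \<omega>) -` C j \<inter> space M))"
      by (rule indep_varsD[OF rows]) (use J1 C in auto)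
    also have "\<dots> = (\<Prod>j\<in>J1. \<Prod>i\<in>J2 j. prob (E (j, i)))"
    proof (intro prod.cong refl)
      fix j assume j: "j \<in> J1"
      have "prob (\<Inter>i\<in>J2 j. X j i -` B (j, i) \<inter> space M) = (\<Prod>i\<in>J2 j. prob (X j i -` B (j, i) \<inter> space M))"
        using J2_ne[OF j] J2 J1 j B(1) by (intro indep_varsD[OF entries]) (auto simp: J2_def)
      moreover have "X j i -` B (j, i) \<inter> space M = E (j, i)" if "i \<in> J2 j" for i
        using that B(2) by (simp add: J2_def)
      ultimately show "prob ((\<lambda>\<omega> i. X j i \<omega>) -` C j \<inter> space M) = (\<Prod>i\<in>J2 j. prob (E (j, i)))"
        by (simp add: CX[OF j])
    qed
    also have "\<dots> = (\<Prod>p\<in>J. prob (E p))"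
      unfolding J_Sigma using J1 J2 by (simp add: prod.Sigma case_prod_beta)
    finally show "prob (\<Inter>p\<in>J. E p) = (\<Prod>p\<in>J. prob (E p))" .
  qed (auto intro!: measurable_sets rv)
  moreover have "(case p of (j, i) \<Rightarrow> X j i) \<in> measurable M N" if "p \<in> A \<times> UNIV" for p
    using that rv by auto
  ultimately show ?thesis unfolding indep_vars_def2 by simp
qed

end

section \<open>The two comparison inequalities\<close>

context chaos
begin

text \<open>The transformation with parameters \<open>c = (r, \<theta>)\<close> puts \<open>\<xi> i\<close> into slot \<open>r\<close> and multiplies the variables
  in the other slots by \<open>\<theta>\<close>. Averaging over \<open>\<theta>\<close> removes the latter, so every slot is left with
  \<open>\<xi> i / k\<close>.\<close>

lemma coupled_le_decoupled:
  assumes M: "prob_space M" and "k > 0"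
    and entries: "\<And>j. j \<le> k \<Longrightarrow> indep_entries M (case_nat \<xi> \<eta> j)"
    and indep: "indep_sequences M k (case_nat \<xi> \<eta>)"
    and ident: "ident_distr_sequences M k (case_nat \<xi> \<eta>)"
    and symm: "\<And>j i. j \<le> k \<Longrightarrow> symmetric_rv M (case_nat \<xi> \<eta> j i)"
    and A: "2 * real k ^ k \<le> A" "hyper_const k (2 * k) \<le> A" and "t \<ge> 0"
  shows "\<P>(\<omega> in M. A * t \<le> N (Q k f (\<lambda>_. \<xi>) \<omega>)) \<le> A * \<P>(\<omega> in M. t \<le> N (Q k f \<eta> \<omega>))"
proof -
  interpret prob_space M by fact
  define S where "S = case_nat \<xi> \<eta>"
  have S0: "S 0 = \<xi>" and S_Suc: "S (Suc j) = \<eta> j" for j by (auto simp: S_def)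
  have rv: "S j i \<in> borel_measurable M" if "j \<le> k" for j i
    using entries[OF that] by (auto simp: indep_entries_def indep_vars_def S_def)
  have all_indep: "indep_vars (\<lambda>_. borel) (\<lambda>(j, i). S j i) ({..k} \<times> UNIV)"
    using indep entries by (intro indep_vars_Times) (auto simp: indep_sequences_def indep_entries_def S_def)
  have distr_S: "distr M borel (S j i) = distr M borel (S 0 i)" if "j \<le> k" for j i
  proof -
    have "distr (distr M seq_space (\<lambda>\<omega> i. S l i \<omega>)) borel (\<lambda>x. x i) = distr M borel (S l i)" if "l \<le> k" for l
      using rv[OF that] by (subst distr_distr) (auto simp: comp_def intro!: measurable_PiM_single')
    from this[of j] this[of 0] show ?thesis
      using that ident by (simp add: ident_distr_sequences_def S_def)
  qed
  have distr_neg: "distr M borel (\<lambda>\<omega>. - S j i \<omega>) = distr M borel (S j i)" if "j \<le> k" for j i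
    using symm[OF that, of i] by (simp add: symmetric_rv_def S_def)
  define C where "C = {..<k} \<times> {-1, 1 :: real}"
  have C: "finite C" "C \<noteq> {}" "card C = 2 * k" using \<open>k > 0\<close> by (auto simp: C_def)
  define Y where "Y j i c \<omega> = (if j = fst c then \<xi> i \<omega> else snd c * \<eta> j i \<omega>)"
    for j i and c :: "nat \<times> real" and \<omega>
  have randomized: "\<P>(\<omega> in M. 2 * t \<le> N (Q k f (\<lambda>j i \<omega>. avg C (\<lambda>c. Y j i c \<omega>)) \<omega>))
      \<le> hyper_const k (card C) * \<P>(\<omega> in M. t \<le> N (Q k f \<eta> \<omega>))"
  proof (rule randomized_choice[OF M C(1,2)])
    fix j i and c :: "nat \<times> real" assume "j < k" "c \<in> C"
    then show "Y j i c \<in> borel_measurable M"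
      using rv[of 0 i] rv[of "Suc j" i] by (auto simp: Y_def[abs_def] S0 S_Suc)
  next
    fix \<tau> :: "nat \<Rightarrow> nat \<times> real" assume \<tau>: "\<And>i. \<tau> i \<in> C"
    \<comment> \<open>\<open>\<sigma>\<close> is the injective relabelling of the array and \<open>s\<close> the sign effected by the choice \<open>\<tau>\<close>.\<close>
    define \<sigma> where "\<sigma> = (\<lambda>(j, i). (if j = fst (\<tau> i) then 0 else Suc j, i))"
    define s where "s = (\<lambda>(j, i). if j = fst (\<tau> i) then 1 else snd (\<tau> i))"
    let ?P = "{..<k} \<times> (UNIV :: nat set)"
    define X where "X p \<omega> = s p * (case \<sigma> p of (j, i) \<Rightarrow> S j i) \<omega>" for p \<omega>
    have X_Y: "X (j, i) = Y j i (\<tau> i)" for j i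
      by (auto simp: X_def[abs_def] Y_def[abs_def] s_def \<sigma>_def S0 S_Suc)
    have "inj_on \<sigma> ?P" by (auto simp: inj_on_def \<sigma>_def split: if_splits)
    moreover have "\<sigma> ` ?P \<subseteq> {..k} \<times> UNIV" by (auto simp: \<sigma>_def)
    ultimately have "indep_vars (\<lambda>_. borel) (\<lambda>p. (\<lambda>(j, i). S j i) (\<sigma> p)) ?P"
      by (rule indep_vars_reindex_inj[OF all_indep])
    then have X: "indep_vars (\<lambda>_. borel) X ?P"
      unfolding X_def by (rule indep_vars_compose2[where Y = "\<lambda>p x. s p * x"]) auto
    have "inj_on (\<lambda>(j, i). (Suc j, i)) ?P" by (auto simp: inj_on_def)
    then have "indep_vars (\<lambda>_. borel) (\<lambda>p. (\<lambda>(j, i). S j i) ((\<lambda>(j, i). (Suc j, i)) p)) ?P"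
      by (rule indep_vars_reindex_inj[OF all_indep]) auto
    then have eta: "indep_vars (\<lambda>_. borel) (\<lambda>(j, i). \<eta> j i) ?P"
      by (simp add: case_prod_unfold S_Suc)
    have marg: "distr M borel (X p) = distr M borel ((\<lambda>(j, i). \<eta> j i) p)" if pP: "p \<in> ?P" for p
    proof -
      obtain j i where p: "p = (j, i)" "j < k" using pP by auto
      have "snd (\<tau> i) = 1 \<or> snd (\<tau> i) = -1" using \<tau>[of i] by (auto simp: C_def)
      then have "distr M borel (X p) = distr M borel (S 0 i)"
        using distr_neg[of "Suc j" i] distr_S[of "Suc j" i] p
        by (cases "j = fst (\<tau> i)") (auto simp: X_Y Y_def[abs_def] S0 S_Suc)
      also have "\<dots> = distr M borel (\<eta> j i)"
        using distr_S[of "Suc j" i] p by (simp add: S_Suc)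
      finally show ?thesis by (simp add: p)
    qed
    have "\<P>(\<omega> in M. t \<le> N (Q k f (\<lambda>j i. X (j, i)) \<omega>))
        = \<P>(\<omega> in M. t \<le> N (Q k f (\<lambda>j i. (\<lambda>(j, i). \<eta> j i) (j, i)) \<omega>))"
      using \<open>k > 0\<close> by (intro prob_norm_Q_eq[OF M _ X eta marg]) auto
    then show "\<P>(\<omega> in M. t \<le> N (Q k f (\<lambda>j i. Y j i (\<tau> i)) \<omega>)) \<le> \<P>(\<omega> in M. t \<le> N (Q k f \<eta> \<omega>))"
      by (simp add: X_Y)
  qed
  have averaged: "N (Q k f (\<lambda>j i \<omega>. avg C (\<lambda>c. Y j i c \<omega>)) \<omega>) = (1 / real k) ^ k * N (Q k f (\<lambda>_. \<xi>) \<omega>)" for \<omega>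
  proof -
    have avgY: "avg C (\<lambda>c. Y j i c \<omega>) = 1 / real k * \<xi> i \<omega>" if "j < k" for j i
    proof -
      have "(\<Sum>c\<in>C. Y j i c \<omega>) = (\<Sum>r<k. \<Sum>\<theta>\<in>{-1, 1}. Y j i (r, \<theta>) \<omega>)"
        unfolding C_def sum.cartesian_product by (intro sum.cong) auto
      also have "\<dots> = (\<Sum>r<k. if j = r then 2 * \<xi> i \<omega> else 0)"
        by (intro sum.cong) (auto simp: Y_def)
      also have "\<dots> = 2 * \<xi> i \<omega>" using that by simp
      finally show ?thesis by (simp add: avg_def C(3))
    qed
    have "Q k f (\<lambda>j i \<omega>. avg C (\<lambda>c. Y j i c \<omega>)) \<omega> = Q k f (\<lambda>j i \<omega>. 1 / real k * \<xi> i \<omega>) \<omega>"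
      by (intro Q_cong) (use avgY in simp)
    also have "\<dots> = (1 / real k) ^ k *\<^sub>R Q k f (\<lambda>_. \<xi>) \<omega>" by (rule Q_scale)
    finally show ?thesis by (simp add: scale Q_in_space)
  qed
  have "2 * t \<le> (1 / real k) ^ k * x" if "A * t \<le> x" for x
  proof -
    have "2 * real k ^ k * t \<le> x" using mult_right_mono[OF A(1) \<open>t \<ge> 0\<close>] that by linarith
    then show ?thesis using \<open>k > 0\<close> by (simp add: field_simps)
  qed
  moreover have "(\<lambda>\<omega>. N (Q k f (\<lambda>_. \<xi>) \<omega>)) \<in> borel_measurable M"
    using rv[of 0] by (intro borel_measurable_norm_Q) (simp add: S0)
  ultimately have "\<P>(\<omega> in M. A * t \<le> N (Q k f (\<lambda>_. \<xi>) \<omega>))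
      \<le> \<P>(\<omega> in M. 2 * t \<le> N (Q k f (\<lambda>j i \<omega>. avg C (\<lambda>c. Y j i c \<omega>)) \<omega>))"
    unfolding averaged by (intro finite_measure_mono) auto
  also note randomized
  also have "hyper_const k (card C) * \<P>(\<omega> in M. t \<le> N (Q k f \<eta> \<omega>)) \<le> A * \<P>(\<omega> in M. t \<le> N (Q k f \<eta> \<omega>))"
    using A by (intro mult_right_mono) (auto simp: C(3))
  finally show ?thesis .
qed

text \<open>The polarization formula and the triangle inequality; its factor \<open>1 / k!\<close> is bounded by 1.\<close>

lemma symmetrized_le_sum_over_subsets:
  "N (Q k (symmetrization k f) X \<omega>) \<le> (\<Sum>A\<in>Pow {..<k}. N (Q k f (\<lambda>_ i \<omega>. \<Sum>a\<in>A. X a i \<omega>) \<omega>))"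
proof -
  let ?W = "\<lambda>A. (-1) ^ (k - card A) *\<^sub>R Q k f (\<lambda>_ i \<omega>. \<Sum>a\<in>A. X a i \<omega>) \<omega>"
  have W: "?W A \<in> V" for A by (intro subspace_scale subspace Q_in_space)
  have "N (Q k (symmetrization k f) X \<omega>) = 1 / fact k * N (\<Sum>A\<in>Pow {..<k}. ?W A)"
    unfolding Q_symmetrization[OF finite_support] by (subst scale) (auto intro!: subspace_sum subspace W)
  also have "\<dots> \<le> 1 * N (\<Sum>A\<in>Pow {..<k}. ?W A)"
    by (intro mult_right_mono nonneg subspace_sum subspace W) (simp_all add: fact_ge_1)
  also have "\<dots> \<le> (\<Sum>A\<in>Pow {..<k}. N (?W A))"
    using sum_le[of "Pow {..<k}" ?W] W by simp
  finally show ?thesis by (simp add: scale Q_in_space power_abs)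
qed

text \<open>For independent columns, taking at each index \<open>i\<close> the entry of an arbitrary sequence among those
  in \<open>A\<close> yields a sequence with the law of \<open>\<xi>\<close>, since interchangeability makes the marginal laws in a
  column equal.\<close>

lemma mixed_le_coupled:
  assumes M: "prob_space M"
    and indep: "jointly_indep_entries M k (case_nat \<xi> \<eta>)"
    and inter: "interchangeable M k (case_nat \<xi> \<eta>)"
    and A: "A \<subseteq> {..<k}" "A \<noteq> {}" and "t \<ge> 0"
  shows "\<P>(\<omega> in M. 2 * real k ^ k * t \<le> N (Q k f (\<lambda>_ i \<omega>. \<Sum>a\<in>A. \<eta> a i \<omega>) \<omega>))
    \<le> hyper_const k k * \<P>(\<omega> in M. t \<le> N (Q k f (\<lambda>_. \<xi>) \<omega>))"
proof -
  interpret prob_space M by fact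
  define S where "S = case_nat \<xi> \<eta>"
  have S0: "S 0 = \<xi>" and S_Suc: "S (Suc j) = \<eta> j" for j by (auto simp: S_def)
  have rv: "S j i \<in> borel_measurable M" if "j \<le> k" for j i
    using inter that by (auto simp: interchangeable_def S_def)
  have finA: "finite A" using A finite_subset by auto
  have cardA: "card A \<le> k" "0 < card A" using A finA card_mono[of "{..<k}" A] by (auto simp: card_gt_0_iff)
  have distr_S: "distr M borel (S j i) = distr M borel (S 0 i)" if "j \<le> k" for j i
  proof -
    let ?D = "PiM {..k} (\<lambda>_. seq_space)"
    have project: "distr (distr M ?D (\<lambda>\<omega>. \<lambda>j\<in>{..k}. \<lambda>i. S (\<pi> j) i \<omega>)) borel (\<lambda>x. x 0 i) = distr M borel (S (\<pi> 0) i)"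
      if "\<pi> permutes {..k}" for \<pi>
    proof -
      have "\<pi> j \<le> k" if "j \<le> k" for j using \<open>\<pi> permutes {..k}\<close> that by (metis atMost_iff permutes_in_image)
      then have meas: "(\<lambda>\<omega>. \<lambda>j\<in>{..k}. \<lambda>i. S (\<pi> j) i \<omega>) \<in> measurable M ?D"
        using rv by (intro measurable_restrict measurable_PiM_single') auto
      have "(\<lambda>x. x 0) \<in> measurable ?D seq_space" by (intro measurable_component_singleton) simp
      then have "(\<lambda>x. x 0 i) \<in> measurable ?D borel"
        by (rule measurable_compose[where g = "\<lambda>y. y i"]) simp
      with meas show ?thesis by (subst distr_distr) (auto simp: comp_def)
    qed
    \<comment> \<open>Exchanging the sequences 0 and \<open>j\<close> moves the marginal law at \<open>j\<close> to position 0.\<close>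
    have "Transposition.transpose 0 j permutes {..k}" using that by (intro permutes_swap_id) auto
    with project[OF this] project[OF permutes_id] inter show ?thesis
      by (simp add: interchangeable_def S_def)
  qed
  have "\<P>(\<omega> in M. 2 * t \<le> N (Q k f (\<lambda>j i \<omega>. avg A (\<lambda>a. \<eta> a i \<omega>)) \<omega>))
      \<le> hyper_const k (card A) * \<P>(\<omega> in M. t \<le> N (Q k f (\<lambda>_. \<xi>) \<omega>))"
  proof (rule randomized_choice[OF M finA A(2), where Y = "\<lambda>j i a. \<eta> a i"])
    show "\<eta> a i \<in> borel_measurable M" if "a \<in> A" for a i
      using rv[of "Suc a" i] that A by (auto simp: S_Suc)
  next
    fix \<tau> :: "nat \<Rightarrow> nat" assume \<tau>: "\<And>i. \<tau> i \<in> A"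
    then have \<tau>k: "Suc (\<tau> i) \<le> k" for i using A by (meson Suc_leI lessThan_iff subsetD)
    have select: "indep_vars (\<lambda>_. borel) (\<lambda>i. S (h i) i) UNIV" if "\<And>i. h i \<le> k" for h
    proof -
      have "indep_vars (\<lambda>_. borel) (\<lambda>i \<omega>. (\<lambda>j\<in>{..k}. S j i \<omega>) (h i)) UNIV"
        using indep unfolding jointly_indep_entries_def S_def
        by (rule indep_vars_compose2[where Y = "\<lambda>i x. x (h i)"]) (use that in simp)
      then show ?thesis using that by simp
    qed
    have "\<P>(\<omega> in M. t \<le> N (Q k f (\<lambda>j i. (\<lambda>i. S (Suc (\<tau> i)) i) i) \<omega>))
        = \<P>(\<omega> in M. t \<le> N (Q k f (\<lambda>j i. (\<lambda>i. S 0 i) i) \<omega>))"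
      using distr_S[OF \<tau>k]
      by (intro prob_norm_Q_eq[OF M _ select[of "\<lambda>i. Suc (\<tau> i)", OF \<tau>k] select[of "\<lambda>_. 0"], where h = "\<lambda>j i. i"]) auto
    then show "\<P>(\<omega> in M. t \<le> N (Q k f (\<lambda>j i. \<eta> (\<tau> i) i) \<omega>)) \<le> \<P>(\<omega> in M. t \<le> N (Q k f (\<lambda>_. \<xi>) \<omega>))"
      by (simp add: S0 S_Suc)
  qed
  also have "\<dots> \<le> hyper_const k k * \<P>(\<omega> in M. t \<le> N (Q k f (\<lambda>_. \<xi>) \<omega>))"
    by (intro mult_right_mono hyper_const_mono cardA) auto
  finally have *: "\<P>(\<omega> in M. 2 * t \<le> N (Q k f (\<lambda>j i \<omega>. avg A (\<lambda>a. \<eta> a i \<omega>)) \<omega>))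
      \<le> hyper_const k k * \<P>(\<omega> in M. t \<le> N (Q k f (\<lambda>_. \<xi>) \<omega>))" .
  have "\<P>(\<omega> in M. 2 * real k ^ k * t \<le> N (Q k f (\<lambda>_ i \<omega>. \<Sum>a\<in>A. \<eta> a i \<omega>) \<omega>))
      \<le> \<P>(\<omega> in M. 2 * t \<le> N (Q k f (\<lambda>j i \<omega>. avg A (\<lambda>a. \<eta> a i \<omega>)) \<omega>))"
  proof (rule finite_measure_mono)
    have "2 * t \<le> N (Q k f (\<lambda>j i \<omega>. avg A (\<lambda>a. \<eta> a i \<omega>)) \<omega>)"
      if "2 * real k ^ k * t \<le> N (Q k f (\<lambda>_ i \<omega>. \<Sum>a\<in>A. \<eta> a i \<omega>) \<omega>)" for \<omega>
    proof -
      have "(\<lambda>j i \<omega>. \<Sum>a\<in>A. \<eta> a i \<omega>) = (\<lambda>(j :: nat) i \<omega>. real (card A) * avg A (\<lambda>a. \<eta> a i \<omega>))"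
        using cardA by (simp add: avg_def)
      then have "N (Q k f (\<lambda>_ i \<omega>. \<Sum>a\<in>A. \<eta> a i \<omega>) \<omega>)
          = real (card A) ^ k * N (Q k f (\<lambda>j i \<omega>. avg A (\<lambda>a. \<eta> a i \<omega>)) \<omega>)"
        by (simp only: Q_scale) (simp add: scale Q_in_space)
      also have "\<dots> \<le> real k ^ k * N (Q k f (\<lambda>j i \<omega>. avg A (\<lambda>a. \<eta> a i \<omega>)) \<omega>)"
        using cardA by (intro mult_right_mono power_mono nonneg Q_in_space) auto
      finally have "real k ^ k * (2 * t) \<le> real k ^ k * N (Q k f (\<lambda>j i \<omega>. avg A (\<lambda>a. \<eta> a i \<omega>)) \<omega>)"
        using that by (simp add: mult_ac)
      then show ?thesis using cardA by (simp add: mult_le_cancel_left)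
    qed
    then show "{\<omega>\<in>space M. 2 * real k ^ k * t \<le> N (Q k f (\<lambda>_ i \<omega>. \<Sum>a\<in>A. \<eta> a i \<omega>) \<omega>)}
        \<subseteq> {\<omega>\<in>space M. 2 * t \<le> N (Q k f (\<lambda>j i \<omega>. avg A (\<lambda>a. \<eta> a i \<omega>)) \<omega>)}" by blast
    have "\<eta> a i \<in> borel_measurable M" if "a \<in> A" for a i
      using rv[of "Suc a" i] that A by (auto simp: S_Suc)
    then have "(\<lambda>\<omega>. N (Q k f (\<lambda>j i \<omega>. avg A (\<lambda>a. \<eta> a i \<omega>)) \<omega>)) \<in> borel_measurable M"
      unfolding avg_def by (intro borel_measurable_norm_Q) auto
    then show "{\<omega>\<in>space M. 2 * t \<le> N (Q k f (\<lambda>j i \<omega>. avg A (\<lambda>a. \<eta> a i \<omega>)) \<omega>)} \<in> events" by measurable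
  qed
  with * show ?thesis by linarith
qed

text \<open>If the symmetrized chaos is large, then so is one of the at most \<open>2\<^sup>k\<close> mixed chaoses that add up to
  it; the empty set contributes zero because \<open>k > 0\<close>.\<close>

lemma symmetrized_le_coupled:
  assumes M: "prob_space M" and "k > 0"
    and indep: "jointly_indep_entries M k (case_nat \<xi> \<eta>)"
    and inter: "interchangeable M k (case_nat \<xi> \<eta>)"
    and B: "2 ^ k * (2 * real k ^ k) \<le> B" "2 ^ k * hyper_const k k \<le> B" and "t \<ge> 0"
  shows "\<P>(\<omega> in M. B * t \<le> N (Q k (symmetrization k f) \<eta> \<omega>)) \<le> B * \<P>(\<omega> in M. t \<le> N (Q k f (\<lambda>_. \<xi>) \<omega>))"
proof -
  interpret prob_space M by fact
  let ?N = "\<lambda>A \<omega>. N (Q k f (\<lambda>_ i \<omega>. \<Sum>a\<in>A. \<eta> a i \<omega>) \<omega>)"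
  let ?c = "2 * real k ^ k * t"
  let ?Sub = "Pow {..<k} - {{}}"
  define E where "E A = {\<omega>\<in>space M. ?c \<le> ?N A \<omega>}" for A
  have E: "E A \<in> events" if "A \<in> ?Sub" for A
  proof -
    have "\<eta> a i \<in> borel_measurable M" if "a < k" for a i
      using inter that unfolding interchangeable_def by (metis Suc_leI old.nat.simps(5))
    then have "?N A \<in> borel_measurable M"
      using that by (intro borel_measurable_norm_Q borel_measurable_sum) auto
    then show ?thesis unfolding E_def by measurable
  qed
  have "{\<omega>\<in>space M. B * t \<le> N (Q k (symmetrization k f) \<eta> \<omega>)} \<subseteq> (\<Union>A\<in>?Sub. E A)"
  proof (rule subsetI, rule ccontr)
    fix \<omega> assume \<omega>: "\<omega> \<in> {\<omega>\<in>space M. B * t \<le> N (Q k (symmetrization k f) \<eta> \<omega>)}"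
      and "\<omega> \<notin> (\<Union>A\<in>?Sub. E A)"
    then have less: "?N A \<omega> < ?c" if "A \<in> ?Sub" for A using that by (auto simp: E_def not_le)
    have "0 \<le> ?N {..<k} \<omega>" by (intro nonneg Q_in_space)
    also have "\<dots> < ?c" using \<open>k > 0\<close> by (intro less) auto
    finally have "0 < ?c" .
    have "?N {} \<omega> = 0" using \<open>k > 0\<close> by (simp add: Q_def zero zero_power)
    with less \<open>0 < ?c\<close> have "?N A \<omega> < ?c" if "A \<in> Pow {..<k}" for A using that by (cases "A = {}") auto
    then have "(\<Sum>A\<in>Pow {..<k}. ?N A \<omega>) < (\<Sum>A\<in>Pow {..<k}. ?c)"
      by (intro sum_strict_mono) auto
    also have "\<dots> = 2 ^ k * (2 * real k ^ k) * t" by (simp add: card_Pow)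
    also have "\<dots> \<le> B * t" using B \<open>t \<ge> 0\<close> by (intro mult_right_mono)
    finally show False using symmetrized_le_sum_over_subsets[of \<eta> \<omega>] \<omega> by simp
  qed
  then have "\<P>(\<omega> in M. B * t \<le> N (Q k (symmetrization k f) \<eta> \<omega>)) \<le> prob (\<Union>A\<in>?Sub. E A)"
    using E by (intro finite_measure_mono sets.finite_UN) auto
  also have "\<dots> \<le> (\<Sum>A\<in>?Sub. prob (E A))"
    using E by (intro finite_measure_subadditive_finite) auto
  also have "\<dots> \<le> (\<Sum>A\<in>?Sub. hyper_const k k * \<P>(\<omega> in M. t \<le> N (Q k f (\<lambda>_. \<xi>) \<omega>)))"
    unfolding E_def by (intro sum_mono mixed_le_coupled[OF M indep inter]) (use \<open>t \<ge> 0\<close> in auto)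
  also have "\<dots> \<le> 2 ^ k * (hyper_const k k * \<P>(\<omega> in M. t \<le> N (Q k f (\<lambda>_. \<xi>) \<omega>)))"
  proof -
    have "real (card ?Sub) \<le> real (card (Pow {..<k}))" by (intro of_nat_mono card_mono) auto
    then have "real (card ?Sub) \<le> 2 ^ k" by (simp add: card_Pow)
    then have "real (card ?Sub) * (hyper_const k k * \<P>(\<omega> in M. t \<le> N (Q k f (\<lambda>_. \<xi>) \<omega>)))
        \<le> 2 ^ k * (hyper_const k k * \<P>(\<omega> in M. t \<le> N (Q k f (\<lambda>_. \<xi>) \<omega>)))"
      by (intro mult_right_mono mult_nonneg_nonneg hyper_const_nonneg) auto
    then show ?thesis by (simp only: sum_constant of_nat_id)
  qed
  also have "\<dots> \<le> B * \<P>(\<omega> in M. t \<le> N (Q k f (\<lambda>_. \<xi>) \<omega>))"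
    unfolding mult.assoc[symmetric] using B by (intro mult_right_mono) auto
  finally show ?thesis .
qed

end

(* \<eta> j stands for \<xi>_{j+1}, so case_nat \<xi> \<eta> enumerates \<xi>, \<xi>_1, ..., \<xi>_k by 0, ..., k. *)
theorem theorem3p8:
  fixes k :: nat
  assumes "k > 0"
  shows
    "(\<exists>A::real. \<forall>(M :: 'm measure) (V :: 'e::real_vector set) N f \<xi> \<eta>.
        prob_space M \<and>
        banach_space_on V N \<and>
        (\<forall>v. length v = k \<longrightarrow> f v \<in> V) \<and> finitely_supported k f \<and> diagonal_free k f \<and>
        (\<forall>j\<le>k. indep_entries M (case_nat \<xi> \<eta> j)) \<and>
        indep_sequences M k (case_nat \<xi> \<eta>) \<and>
        ident_distr_sequences M k (case_nat \<xi> \<eta>) \<and>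
        (\<forall>j\<le>k. \<forall>i. symmetric_rv M (case_nat \<xi> \<eta> j i)) \<longrightarrow>
        (\<forall>t\<ge>0. \<P>(\<omega> in M. N (Q k f (\<lambda>_. \<xi>) \<omega>) \<ge> A * t)
               \<le> A * \<P>(\<omega> in M. N (Q k f \<eta> \<omega>) \<ge> t)))
     \<and>
     (\<exists>B::real. \<forall>(M :: 'm measure) (V :: 'e::real_vector set) N f \<xi> \<eta>.
        prob_space M \<and>
        banach_space_on V N \<and>
        (\<forall>v. length v = k \<longrightarrow> f v \<in> V) \<and> finitely_supported k f \<and> diagonal_free k f \<and>
        jointly_indep_entries M k (case_nat \<xi> \<eta>) \<and>
        interchangeable M k (case_nat \<xi> \<eta>) \<longrightarrow>
        (\<forall>t\<ge>0. \<P>(\<omega> in M. N (Q k (symmetrization k f) \<eta> \<omega>) \<ge> B * t)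
               \<le> B * \<P>(\<omega> in M. N (Q k f (\<lambda>_. \<xi>) \<omega>) \<ge> t)))"
proof (intro conjI; rule exI; intro allI impI; (elim conjE)?)
  fix M :: "'m measure" and V :: "'e set" and N f \<xi> \<eta> and t :: real
  assume *: "prob_space M" "banach_space_on V N" "\<forall>v. length v = k \<longrightarrow> f v \<in> V"
      "finitely_supported k f" "diagonal_free k f"
    and entries: "\<forall>j\<le>k. indep_entries M (case_nat \<xi> \<eta> j)"
    and **: "indep_sequences M k (case_nat \<xi> \<eta>)" "ident_distr_sequences M k (case_nat \<xi> \<eta>)"
      "\<forall>j\<le>k. \<forall>i. symmetric_rv M (case_nat \<xi> \<eta> j i)" and "t \<ge> 0"
  interpret prob_space M by fact
  interpret chaos V N k f
    using * unfolding banach_space_on_def by unfold_locales auto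
  let ?A = "max (2 * real k ^ k) (hyper_const k (2 * k))"
  show "\<P>(\<omega> in M. ?A * t \<le> N (Q k f (\<lambda>_. \<xi>) \<omega>)) \<le> ?A * \<P>(\<omega> in M. t \<le> N (Q k f \<eta> \<omega>))"
    using \<open>k > 0\<close> \<open>t \<ge> 0\<close> * ** entries by (intro coupled_le_decoupled) auto
next
  fix M :: "'m measure" and V :: "'e set" and N f \<xi> \<eta> and t :: real
  assume *: "prob_space M" "banach_space_on V N" "\<forall>v. length v = k \<longrightarrow> f v \<in> V"
      "finitely_supported k f" "diagonal_free k f"
    and **: "jointly_indep_entries M k (case_nat \<xi> \<eta>)" "interchangeable M k (case_nat \<xi> \<eta>)" and "t \<ge> 0"
  interpret prob_space M by fact
  interpret chaos V N k f
    using * unfolding banach_space_on_def by unfold_locales auto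
  let ?B = "max (2 ^ k * (2 * real k ^ k)) (2 ^ k * hyper_const k k)"
  show "\<P>(\<omega> in M. ?B * t \<le> N (Q k (symmetrization k f) \<eta> \<omega>)) \<le> ?B * \<P>(\<omega> in M. t \<le> N (Q k f (\<lambda>_. \<xi>) \<omega>))"
    using \<open>k > 0\<close> \<open>t \<ge> 0\<close> * ** by (intro symmetrized_le_coupled) auto
qed

end
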